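(* Let $N$ be an even positive integer, $h=2\pi/N$, and let $T>0$ be given and fixed. Consider the system $$\frac{dU_k}{d\tau}+\frac{U_k(U_{k+1}-U_{k-1})}{2h\,\varepsilon}=\frac{U_{k+1}-2U_k+U_{k-1}}{h^2},\qquad k=1,\dots,N,\quad U_{k+N}=U_k,\qquad (\ast)$$ with a given initial condition $U^0$ in the positive orthant of $\mathbb{R}^N$ (alternatively, with initial conditions $U^0_\varepsilon$, possibly depending on $\varepsilon$, lying in a compact set in the positive orthant of $\mathbb{R}^N$). For $\varepsilon>0$ let $U_\varepsilon(\tau)$ denote the solution of $(\ast)$ over the interval $[0,T]$. Let $\varepsilon_i\to 0$ be a sequence such that $U_{\varepsilon_i}(\tau)$ converges as $i\to\infty$, in the sense of Young measures on $[0,T]$, to a Young measure $\mu_0(\tau)$, $\tau\in[0,T]$, where for almost every $\tau\in[0,T]$ the measure $\mu_0(\tau)$ is an invariant measure of the fast equation $$\frac{dU_k}{d\sigma}+U_k(U_{k+1}-U_{k-1})=0,\qquad k=1,\dots,N,\quad U_{k+N}=U_k.$$ Let $v_1,\dots,v_{N/2+1}$ be the observables, and $\hat v_j(\mu)$ the measurement of $v_j$ on an invariant measure $\mu$, both defined in the context, and denote $\hat v_j(\tau)=\hat v_j(\mu_0(\tau))$. Then for each $v_j$, $j=1,2,\dots,\frac N2+1$, the function $\hat v_j(\tau)=\hat v_j(\mu_0(\tau))$ satisfies the differential equation $$\frac{d\hat v_j}{d\tau}(\tau)=\int_{\mathbb{R}^N}(\nabla v_j)(U)\cdot G(U)\,\mu_0(\tau)(dU),\qquad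 \hat v_j(0)=v_j(U(0)),$$ where $G(U)\in\mathbb{R}^N$ is the vector field with components $G_k(U)=\frac{1}{h^2}(U_{k+1}-2U_k+U_{k-1})$, $k=1,\dots,N$, and $\nabla$ is taken with respect to the vector $U$. Furthermore, the sequence of measurements $v_j(U_{\varepsilon_i}(\tau))$ converges weakly to $\hat v_j(\mu_0(\tau))$ as $i\to\infty$, for $j=1,2,\dots,\frac N2+1$.
   Context: $U=(U_1,\dots,U_N)$; indices are modulo $N$; the positive orthant is the set where $U_k>0$ for all $k$. Observables: for $U$ in the positive orthant put $A_k=U_k^{1/2}$ (extended $N$-periodically in $k$) and let $L=L(U)$ be the symmetric $N\times N$ matrix acting on $N$-periodic vectors $x$ by $(Lx)_k=A_kx_{k+1}+A_{k-1}x_{k-1}$. Set $v_j(U)=\operatorname{tr}\big(L(U)^{2j}\big)$ for $j=1,\dots,\frac N2$, and $v_{N/2+1}(U)=U_1U_2\cdots U_N$. These functions are first integrals (invariants) of the fast equation. Measurement on invariant measures: the invariance of each $v_j$ is taken to imply that whenever $\mu$ is an invariant measure of the fast equation, the observed value $v_j(U)$ is constant on the support of $\mu$; this value is denoted $\hat v_j(\mu)$. Young measures: a Young measure on $[0,T]$ is a map $\tau\mapsto\mu(\tau)$ from $[0,T]$ to probability measures on $\mathbb{R}^N$; it can also be viewed as a measure on $[0,T]\times\mathbb{R}^N$. A function $U:[0,T]\to\mathbb{R}^N$ is viewed as the Young measure whose value at $\tau$ is the Dirac measure supported on $\{U(\tau)\}$. Convergence in the sense of Young measures is weak convergence of the associated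 measures on $[0,T]\times\mathbb{R}^N$. *)

theory Defs
  imports "HOL-Analysis.Analysis" "HOL-Probability.Giry_Monad" "HOL-Library.Numeral_Type"
begin

text \<open>
  Vectors \<open>U = (U\<^sub>1, \<dots>, U\<^sub>N)\<close> with indices modulo \<open>N\<close> are elements of \<open>real ^ 'n\<close> whose index
  type is a finite ring, so that \<open>U $ (k + 1)\<close> and \<open>U $ (k - 1)\<close> are the cyclic neighbours once
  \<open>'n\<close> is the ring of integers modulo \<open>N\<close>. The library type \<open>'m bit0\<close> is that ring for
  \<open>N = 2 * CARD('m)\<close>; as \<open>'m\<close> ranges over the finite types, \<open>N\<close> ranges over all even positive
  integers.
\<close>

definition positive_orthant :: "(real ^ 'n::finite) set" where
  "positive_orthant = {U. \<forall>k. U $ k > 0}"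


subsection \<open>The equations\<close>

definition convection :: "real ^ 'n::{finite,comm_ring_1} \<Rightarrow> real ^ 'n::{finite,comm_ring_1}" where
  "convection U = (\<chi> k. U $ k * (U $ (k + 1) - U $ (k - 1)))"

definition diffusion :: "real \<Rightarrow> real ^ 'n::{finite,comm_ring_1} \<Rightarrow> real ^ 'n::{finite,comm_ring_1}" where
  "diffusion h U = (\<chi> k. (1 / h\<^sup>2) * (U $ (k + 1) - 2 * U $ k + U $ (k - 1)))"

definition full_solution ::
    "real \<Rightarrow> real \<Rightarrow> real \<Rightarrow> (real \<Rightarrow> real ^ 'n::{finite,comm_ring_1}) \<Rightarrow> bool" where
  "full_solution h \<epsilon> T X \<longleftrightarrow>
    (\<forall>\<tau>\<in>{0..T}. (X has_vector_derivative
        (diffusion h (X \<tau>) - (1 / (2 * h * \<epsilon>)) *\<^sub>R convection (X \<tau>))) (at \<tau> within {0..T}))"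

definition fast_solution :: "(real \<Rightarrow> real ^ 'n::{finite,comm_ring_1}) \<Rightarrow> bool" where
  "fast_solution X \<longleftrightarrow> (\<forall>\<sigma>. (X has_vector_derivative - convection (X \<sigma>)) (at \<sigma>))"


subsection \<open>Invariant measures of the fast equation\<close>

text \<open>
  Off the positive orthant a solution of the fast equation need not exist for all times, so the
  flow is considered on the set of points through which a global solution passes (this set contains
  the positive orthant). The global solution is unique because the vector field is polynomial.
\<close>

definition fast_flow_domain :: "(real ^ 'n::{finite,comm_ring_1}) set" where
  "fast_flow_domain = {x. \<exists>X. fast_solution X \<and> X 0 = x}"

definition fast_flow :: "real \<Rightarrow> real ^ 'n::{finite,comm_ring_1} \<Rightarrow> real ^ 'n::{finite,comm_ring_1}" where
  "fast_flow \<sigma> x = (THE y. \<exists>X. fast_solution X \<and> X 0 = x \<and> X \<sigma> = y)"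

definition fast_invariant_measure :: "(real ^ 'n::{finite,comm_ring_1}) measure \<Rightarrow> bool" where
  "fast_invariant_measure \<mu> \<longleftrightarrow>
    prob_space \<mu> \<and> sets \<mu> = sets borel \<and>
    (AE x in \<mu>. x \<in> fast_flow_domain) \<and>
    (\<forall>\<sigma>. \<forall>B\<in>sets borel. emeasure \<mu> {x \<in> fast_flow_domain. fast_flow \<sigma> x \<in> B} = emeasure \<mu> B)"

definition measure_support :: "'a::topological_space measure \<Rightarrow> 'a set" where
  "measure_support \<mu> = {x. \<forall>W. open W \<and> x \<in> W \<longrightarrow> emeasure \<mu> W > 0}"


subsection \<open>Observables\<close>

definition lax_matrix :: "real ^ 'n::{finite,comm_ring_1} \<Rightarrow> real ^ 'n::{finite,comm_ring_1} ^ 'n::{finite,comm_ring_1}" where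
  "lax_matrix U = matrix (\<lambda>x. \<chi> k. sqrt (U $ k) * x $ (k + 1) + sqrt (U $ (k - 1)) * x $ (k - 1))"

text \<open>The operation \<open>*\<close> on \<open>real ^ 'n ^ 'n\<close>, and hence \<open>^\<close>, is entrywise; powers are taken
  with respect to the matrix product \<open>**\<close>.\<close>

definition matrix_power :: "real ^ 'n ^ 'n::finite \<Rightarrow> nat \<Rightarrow> real ^ 'n ^ 'n::finite" where
  "matrix_power L m = (((**) L) ^^ m) (mat 1)"

text \<open>The index \<open>j\<close> runs through \<open>1, \<dots>, N div 2 + 1\<close>. Only values on the positive orthant are
  meaningful.\<close>

definition observable :: "nat \<Rightarrow> real ^ 'n::{finite,comm_ring_1} \<Rightarrow> real" where
  "observable j U =
    (if j \<le> CARD('n) div 2 then trace (matrix_power (lax_matrix U) (2 * j)) else \<Prod>k\<in>UNIV. U $ k)"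

definition measurement :: "nat \<Rightarrow> (real ^ 'n::{finite,comm_ring_1}) measure \<Rightarrow> real" where
  "measurement j \<mu> = (THE c. \<forall>U\<in>measure_support \<mu>. observable j U = c)"

definition grad :: "('a::real_inner \<Rightarrow> real) \<Rightarrow> 'a \<Rightarrow> 'a" where
  "grad f x = (THE D. GDERIV f x :> D)"


subsection \<open>Young measures\<close>

definition young_measure :: "real \<Rightarrow> (real \<Rightarrow> 'a::euclidean_space measure) \<Rightarrow> bool" where
  "young_measure T \<mu> \<longleftrightarrow> \<mu> \<in> lebesgue_on {0..T} \<rightarrow>\<^sub>M prob_algebra borel"

text \<open>The measure \<open>A \<mapsto> \<integral>\<^bsub>[0,T]\<^esub> \<mu>(\<tau>) {U. (\<tau>, U) \<in> A} d\<tau>\<close> on \<open>[0,T] \<times> \<real>\<^sup>N\<close>.\<close>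

definition young_assoc :: "real \<Rightarrow> (real \<Rightarrow> 'a::euclidean_space measure) \<Rightarrow> (real \<times> 'a) measure" where
  "young_assoc T \<mu> =
    lebesgue_on {0..T} \<bind> (\<lambda>\<tau>. distr (\<mu> \<tau>) (restrict_space borel ({0..T} \<times> UNIV)) (Pair \<tau>))"

definition weak_measure_conv ::
    "'a::topological_space set \<Rightarrow> (nat \<Rightarrow> 'a measure) \<Rightarrow> 'a measure \<Rightarrow> bool" where
  "weak_measure_conv S M M0 \<longleftrightarrow>
    (\<forall>f::'a \<Rightarrow> real. continuous_on S f \<and> bounded (f ` S) \<longrightarrow>
      (\<lambda>i. \<integral>x. f x \<partial>M i) \<longlonglongrightarrow> (\<integral>x. f x \<partial>M0))"

definition young_conv ::
    "real \<Rightarrow> (nat \<Rightarrow> real \<Rightarrow> 'a::euclidean_space measure) \<Rightarrow> (real \<Rightarrow> 'a measure) \<Rightarrow> bool" where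
  "young_conv T \<mu>s \<mu> \<longleftrightarrow>
    weak_measure_conv ({0..T} \<times> UNIV) (\<lambda>i. young_assoc T (\<mu>s i)) (young_assoc T \<mu>)"

definition dirac_young :: "(real \<Rightarrow> 'a::euclidean_space) \<Rightarrow> real \<Rightarrow> 'a measure" where
  "dirac_young X \<tau> = return borel (X \<tau>)"


subsection \<open>Differential equations with measurable right-hand side and weak convergence\<close>

definition absolutely_continuous_on :: "real set \<Rightarrow> (real \<Rightarrow> real) \<Rightarrow> bool" where
  "absolutely_continuous_on S w \<longleftrightarrow>
    (\<forall>e>0. \<exists>\<delta>>0. \<forall>\<D>. \<D> division_of \<Union>\<D> \<and> \<Union>\<D> \<subseteq> S \<and> (\<Sum>I\<in>\<D>. Sup I - Inf I) < \<delta> \<longrightarrow>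
      (\<Sum>I\<in>\<D>. \<bar>w (Sup I) - w (Inf I)\<bar>) < e)"

definition caratheodory_antiderivative :: "real \<Rightarrow> (real \<Rightarrow> real) \<Rightarrow> (real \<Rightarrow> real) \<Rightarrow> bool" where
  "caratheodory_antiderivative T w g \<longleftrightarrow>
    absolutely_continuous_on {0..T} w \<and>
    (AE \<tau> in lebesgue_on {0..T}. (w has_real_derivative g \<tau>) (at \<tau> within {0..T}))"

text \<open>Weak convergence of functions on \<open>[0,T]\<close>, tested against all of \<open>L\<^sup>1\<close>: for uniformly bounded
  sequences this includes weak convergence in every \<open>L\<^sup>p\<close>, \<open>1 \<le> p < \<infinity>\<close>, and weak-star convergence
  in \<open>L\<^sup>\<infinity>\<close>.\<close>

definition weak_function_conv :: "real \<Rightarrow> (nat \<Rightarrow> real \<Rightarrow> real) \<Rightarrow> (real \<Rightarrow> real) \<Rightarrow> bool" where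
  "weak_function_conv T f g \<longleftrightarrow>
    (\<forall>\<phi>. integrable (lebesgue_on {0..T}) \<phi> \<longrightarrow>
      (\<forall>i. integrable (lebesgue_on {0..T}) (\<lambda>\<tau>. \<phi> \<tau> * f i \<tau>)) \<and>
      integrable (lebesgue_on {0..T}) (\<lambda>\<tau>. \<phi> \<tau> * g \<tau>) \<and>
      (\<lambda>i. \<integral>\<tau>. \<phi> \<tau> * f i \<tau> \<partial>lebesgue_on {0..T}) \<longlonglongrightarrow> (\<integral>\<tau>. \<phi> \<tau> * g \<tau> \<partial>lebesgue_on {0..T}))"

end

theory Submission
  imports Defs
begin

text \<open>
  The solutions stay in a fixed box inside the positive orthant: their coordinate sum is conserved
  and, by the AM-GM inequality, their coordinate product is nondecreasing. By a Lax equation for the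
  convection the observables are slow, \<open>d/d\<tau> v\<^sub>j(U\<^sub>\<epsilon>) = \<nabla>v\<^sub>j(U\<^sub>\<epsilon>) \<bullet> G(U\<^sub>\<epsilon>)\<close> with a right-hand side
  bounded uniformly in \<open>\<epsilon>\<close>. Young convergence then gives pointwise convergence of the increments
  \<open>v\<^sub>j(U\<^sub>\<epsilon>(\<tau>)) - v\<^sub>j(U\<^sub>\<epsilon>(0))\<close> to an indefinite integral, and integrating these over \<open>[0,T]\<close> shows
  that the initial values converge as well. Let \<open>v\<close> be the limit of \<open>v\<^sub>j(U\<^sub>\<epsilon>)\<close>. Testing the
  convergence against the continuous function \<open>(\<tau>, V) \<mapsto> (v\<^sub>j(V) - v(\<tau>))\<^sup>2\<close> shows that
  \<open>v\<^sub>j = v(\<tau>)\<close> on the support of the limit measure for almost every \<open>\<tau>\<close>, and Lebesgue's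
  differentiation theorem turns the integral equation for \<open>v\<close> into the differential equation.
\<close>

section \<open>Lebesgue differentiation on an interval\<close>

text \<open>Weak-type bound for the Hardy-Littlewood maximal function via Vitali covering. Disjoint
  bad intervals have radii summing to at most the integral divided by \<open>a\<close>; fivefold
  enlargement gives each a length of ten radii, hence \<open>10 / a\<close>. Since \<open>W\<close>
  is a union of open balls, measurability of the set of bad centres never has to be
  discussed.\<close>

lemma maximal_inequality_real:
  fixes h :: "real \<Rightarrow> real"
  assumes h: "h absolutely_integrable_on UNIV" and a: "0 < a"
  obtains W where "W \<in> lmeasurable" "measure lebesgue W \<le> 10 / a * integral UNIV (\<lambda>t. \<bar>h t\<bar>)"
    "\<And>x r. 0 < r \<Longrightarrow> a * r < integral (cball x r) (\<lambda>t. \<bar>h t\<bar>) \<Longrightarrow> x \<in> W"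
proof -
  define H where "H = (\<lambda>t. \<bar>h t\<bar>)"
  have HU: "H absolutely_integrable_on UNIV"
    using absolutely_integrable_norm[OF h] by (simp add: H_def o_def)
  have HS: "H absolutely_integrable_on S" if "S \<in> sets lebesgue" for S
    using set_integrable_subset[OF HU] that by auto
  have H0: "0 \<le> H t" for t by (simp add: H_def)
  define B where "B = integral UNIV H"
  define K where "K = {p :: real \<times> real. 0 < snd p \<and> a * snd p < integral (cball (fst p) (snd p)) H}"
  have IS: "integral S H \<le> B" if "S \<in> sets lebesgue" for S
    unfolding B_def using HS[OF that] HU H0
    by (intro integral_subset_le) (auto intro: set_lebesgue_integral_eq_integral)
  \<comment> \<open>The Vitali selection requires bounded radii: a bad radius satisfies
    \<open>a * r < B\<close>.\<close>
  have KB: "0 < snd p \<and> snd p \<le> B / a" if "p \<in> K" for p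
    using that IS[of "cball (fst p) (snd p)"] a by (auto simp: K_def field_simps)
  obtain C where C: "countable C" "C \<subseteq> K"
      and dj: "pairwise (\<lambda>i j. disjnt (cball (fst i) (snd i)) (cball (fst j) (snd j))) C"
      and cov: "\<And>i. i \<in> K \<Longrightarrow> \<exists>j. j \<in> C \<and> \<not> disjnt (cball (fst i) (snd i)) (cball (fst j) (snd j)) \<and>
          cball (fst i) (snd i) \<subseteq> ball (fst j) (5 * snd j)"
    using Vitali_covering_lemma_cballs_balls[of K snd "B / a" fst] KB by blast
  define W where "W = (\<Union>p\<in>C. ball (fst p) (5 * snd p))"
  \<comment> \<open>A bound uniform over finite subfamilies carries over to the countable
    union.\<close>
  have fin: "measure lebesgue (\<Union>p\<in>D. ball (fst p) (5 * snd p)) \<le> 10 / a * B"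
    if D: "finite D" "D \<subseteq> C" for D
  proof -
    have DK: "p \<in> K" if "p \<in> D" for p using that D C by auto
    have "measure lebesgue (\<Union>p\<in>D. ball (fst p) (5 * snd p)) \<le> (\<Sum>p\<in>D. measure lebesgue (ball (fst p) (5 * snd p)))"
      by (intro measure_UNION_le D) auto
    also have "\<dots> = (\<Sum>p\<in>D. 10 * snd p)"
      using DK KB by (intro sum.cong refl) (auto simp: ball_eq_greaterThanLessThan less_imp_le)
    also have "\<dots> \<le> (\<Sum>p\<in>D. 10 / a * integral (cball (fst p) (snd p)) H)"
      using DK a by (intro sum_mono) (fastforce simp: K_def field_simps)
    also have "\<dots> = 10 / a * (\<Sum>p\<in>D. integral (cball (fst p) (snd p)) H)"
      by (simp add: sum_distrib_left)
    also have "(\<Sum>p\<in>D. integral (cball (fst p) (snd p)) H) = (\<Sum>p\<in>D. (LINT t:cball (fst p) (snd p)|lebesgue. H t))"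
      by (intro sum.cong refl, subst set_lebesgue_integral_eq_integral(2)) (auto intro: HS)
    also have "\<dots> = (LINT t:(\<Union>p\<in>D. cball (fst p) (snd p))|lebesgue. H t)"
    proof (rule set_integral_finite_Union[symmetric])
      show "disjoint_family_on (\<lambda>p. cball (fst p) (snd p)) D"
        using dj D unfolding disjoint_family_on_def pairwise_def disjnt_def by blast
    qed (use D HS in auto)
    also have "\<dots> = integral (\<Union>p\<in>D. cball (fst p) (snd p)) H"
      using D(1) by (subst set_lebesgue_integral_eq_integral(2)) (auto intro!: HS sets.finite_UN)
    also have "\<dots> \<le> B" using D(1) by (intro IS) auto
    finally show ?thesis using a by (simp add: divide_right_mono mult_left_mono)
  qed
  have "W \<in> lmeasurable" "measure lebesgue W \<le> 10 / a * B"
    unfolding W_def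
    by (rule fmeasurable_UN_bound[OF C(1) _ fin] measure_UN_bound[OF C(1) _ fin]; simp)+
  moreover have "x \<in> W" if "0 < r" "a * r < integral (cball x r) H" for x r
  proof -
    have "(x, r) \<in> K" using that by (simp add: K_def)
    from cov[OF this] obtain j where "j \<in> C" "cball x r \<subseteq> ball (fst j) (5 * snd j)" by auto
    then show ?thesis using \<open>0 < r\<close> unfolding W_def by (force simp: subset_iff)
  qed
  ultimately show thesis using that unfolding B_def H_def by blast
qed

text \<open>Measurability supplies continuous functions converging to \<open>f\<close> off a null
  set. Truncating them at the bound of \<open>f\<close> preserves continuity and the limit, and
  makes dominated convergence applicable.\<close>

lemma bounded_measurable_L1_approx_continuous:
  fixes f :: "real \<Rightarrow> real"
  assumes f: "f \<in> borel_measurable (lebesgue_on {a..b})"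
    and C: "\<And>x. x \<in> {a..b} \<Longrightarrow> \<bar>f x\<bar> \<le> C" and d: "0 < d"
  obtains k where "continuous_on UNIV k" "\<And>x. \<bar>k x\<bar> \<le> \<bar>C\<bar>"
    "(LINT t|lebesgue_on {a..b}. \<bar>k t - f t\<bar>) < d"
proof -
  define fe where "fe = (\<lambda>x. if x \<in> {a..b} then f x else 0)"
  have "fe \<in> borel_measurable lebesgue"
    unfolding fe_def using f by (intro borel_measurable_if_I) auto
  then have "fe measurable_on UNIV"
    by (rule lebesgue_measurable_imp_measurable_on) simp
  then obtain N g where N: "negligible N" and g: "\<And>n. continuous_on UNIV (g n)"
    and lim: "\<And>x. x \<notin> N \<Longrightarrow> (\<lambda>n. g n x) \<longlonglongrightarrow> fe x"
    by (auto simp: measurable_on_def)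
  \<comment> \<open>The level is \<open>\<bar>C\<bar>\<close> because \<open>C\<close> may be
    negative when the interval is empty.\<close>
  define k where "k = (\<lambda>n x. max (- \<bar>C\<bar>) (min \<bar>C\<bar> (g n x)))"
  have kc: "continuous_on UNIV (k n)" for n
    unfolding k_def by (intro continuous_intros g)
  have kb: "\<bar>k n x\<bar> \<le> \<bar>C\<bar>" for n x by (auto simp: k_def)
  have km: "k n \<in> borel_measurable (lebesgue_on {a..b})" for n
    by (rule continuous_imp_measurable_on_sets_lebesgue) (auto intro: continuous_on_subset[OF kc])
  have "AE x in lebesgue. x \<notin> N"
    using N by (intro AE_not_in) (simp add: negligible_iff_null_sets)
  then have AEN: "AE x in lebesgue_on {a..b}. x \<notin> N"
    by (subst AE_restrict_space_iff) (auto elim: AE_mp)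
  have "(\<lambda>n. LINT t|lebesgue_on {a..b}. \<bar>k n t - f t\<bar>) \<longlonglongrightarrow> (LINT t|lebesgue_on {a..b}. 0)"
  proof (rule integral_dominated_convergence[where w = "\<lambda>_. 2 * \<bar>C\<bar>"])
    show "AE x in lebesgue_on {a..b}. (\<lambda>n. \<bar>k n x - f x\<bar>) \<longlonglongrightarrow> 0"
      using AEN AE_space
    proof eventually_elim
      case (elim x)
      then have "f x = fe x" "\<bar>f x\<bar> \<le> C" using C by (auto simp: fe_def)
      moreover have "(\<lambda>n. k n x) \<longlonglongrightarrow> max (- \<bar>C\<bar>) (min \<bar>C\<bar> (fe x))"
        unfolding k_def using lim[OF elim(1)] by (intro tendsto_intros)
      ultimately have "(\<lambda>n. k n x) \<longlonglongrightarrow> f x"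
        by (auto simp: max_def min_def split: if_splits)
      then show ?case by (simp add: LIM_zero tendsto_rabs_zero)
    qed
    show "AE x in lebesgue_on {a..b}. norm \<bar>k n x - f x\<bar> \<le> 2 * \<bar>C\<bar>" for n
      using AE_space
    proof eventually_elim
      case (elim x)
      then have "\<bar>f x\<bar> \<le> C" using C by auto
      with kb[of n x] show ?case by auto
    qed
    show "integrable (lebesgue_on {a..b}) (\<lambda>_. 2 * \<bar>C\<bar>)" 
      by (simp add: finite_measure.integrable_const finite_measure_lebesgue_on)
  qed (use km f in auto)
  then have "\<forall>\<^sub>F n in sequentially. (LINT t|lebesgue_on {a..b}. \<bar>k n t - f t\<bar>) < d"
    using d by (intro order_tendstoD) auto
  then obtain n where "(LINT t|lebesgue_on {a..b}. \<bar>k n t - f t\<bar>) < d"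
    by (auto simp: eventually_sequentially)
  then show thesis using that[OF kc kb] by blast
qed

text \<open>Insert \<open>k y\<close> and \<open>k x\<close> between \<open>f y\<close> and
  \<open>c\<close>: the two steps that involve only \<open>k\<close> and \<open>c\<close> cost at
  most \<open>e\<close> each, which accounts for \<open>2 * e\<close>.\<close>

lemma integral_deviation_bound:
  fixes f k :: "real \<Rightarrow> real"
  assumes st: "s \<le> t" and x: "x \<in> {s..t}"
    and f: "f absolutely_integrable_on {s..t}" and k: "continuous_on UNIV k"
    and e: "\<And>y. y \<in> {s..t} \<Longrightarrow> \<bar>k y - k x\<bar> \<le> e" "\<bar>k x - c\<bar> \<le> e"
  shows "\<bar>integral {s..t} f - c * (t - s)\<bar> \<le> integral {s..t} (\<lambda>y. \<bar>k y - f y\<bar>) + 2 * e * (t - s)"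
proof -
  have k': "k absolutely_integrable_on {s..t}"
    by (rule absolutely_integrable_continuous_real) (auto intro: continuous_on_subset[OF k])
  have kf: "(\<lambda>y. \<bar>k y - f y\<bar>) integrable_on {s..t}"
    using absolutely_integrable_norm[OF set_integral_diff(1)[OF k' f]]
    by (auto simp: o_def intro: set_lebesgue_integral_eq_integral)
  have fi: "f integrable_on {s..t}" using f set_lebesgue_integral_eq_integral by blast
  have "integral {s..t} f - c * (t - s) = integral {s..t} (\<lambda>y. f y - c)"
    using fi st by (subst Henstock_Kurzweil_Integration.integral_diff) (auto simp: mult.commute)
  also have "\<bar>\<dots>\<bar> \<le> integral {s..t} (\<lambda>y. \<bar>k y - f y\<bar> + 2 * e)"
  proof -
    have "norm (integral {s..t} (\<lambda>y. f y - c)) \<le> integral {s..t} (\<lambda>y. \<bar>k y - f y\<bar> + 2 * e)"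
    proof (rule integral_norm_bound_integral)
      show "norm (f y - c) \<le> \<bar>k y - f y\<bar> + 2 * e" if "y \<in> {s..t}" for y
        using e(1)[OF that] e(2) unfolding real_norm_def by linarith
    qed (use fi kf in \<open>auto intro!: integrable_diff integrable_add\<close>)
    then show ?thesis by simp
  qed
  also have "\<dots> = integral {s..t} (\<lambda>y. \<bar>k y - f y\<bar>) + 2 * e * (t - s)"
    using kf st by (subst Henstock_Kurzweil_Integration.integral_add) (auto simp: mult.commute)
  finally show ?thesis .
qed

text \<open>Replace \<open>f\<close> by a continuous \<open>k\<close> close to it in L1. Near a
  point, averages of \<open>k\<close> are harmless; averages of \<open>k - f\<close> are small off
  the exceptional set of the maximal inequality, and the value of \<open>k - f\<close> at the point
  itself is small off a set controlled by Markov's inequality.\<close>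

theorem indefinite_integral_has_derivative_AE:
  fixes f :: "real \<Rightarrow> real"
  assumes f: "f \<in> borel_measurable (lebesgue_on {a..b})"
    and C: "\<And>x. x \<in> {a..b} \<Longrightarrow> \<bar>f x\<bar> \<le> C"
  shows "AE x in lebesgue_on {a..b}. ((\<lambda>u. integral {a..u} f) has_real_derivative f x) (at x within {a..b})"
proof -
  define F where "F = (\<lambda>u. integral {a..u} f)"
  have "set_integrable lebesgue {a..b} f"
    unfolding set_integrable_def integrable_restrict_space[symmetric]
    using C f by (subst integrable_restrict_space[symmetric])
     (auto intro!: finite_measure.integrable_const_bound[where B=C] finite_measure_lebesgue_on AE_I2)
  then have fab: "f absolutely_integrable_on {a..b}" .
  have fst: "f absolutely_integrable_on {s..t}" if "a \<le> s" "t \<le> b" for s t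
    by (rule set_integrable_subset[OF fab]) (use that in auto)
  have Fdiff: "F t - F s = integral {s..t} f" if "a \<le> s" "s \<le> t" "t \<le> b" for s t
    unfolding F_def
    using Henstock_Kurzweil_Integration.integral_combine[of a s t f] fst[of a t] that
      set_lebesgue_integral_eq_integral(1) by (smt (verit))
  \<comment> \<open>\<open>Q e x\<close> is differentiability at \<open>x\<close> with derivative
    \<open>f x\<close> up to a fixed tolerance \<open>e\<close>, so that each tolerance can be
    treated separately.\<close>
  define Q where "Q = (\<lambda>e x. \<exists>\<delta>>0. \<forall>y\<in>{a..b}. \<bar>y - x\<bar> < \<delta> \<longrightarrow> \<bar>F y - F x - f x * (y - x)\<bar> \<le> e * \<bar>y - x\<bar>)"
  define E where "E = (\<lambda>e. {x \<in> {a..b}. \<not> Q e x})"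
  \<comment> \<open>Nothing is known about measurability of \<open>E e\<close>, so it is enclosed in
    measurable sets of arbitrarily small measure.\<close>
  have negE: "negligible (E e)" if e: "0 < e" for e
    unfolding negligible_outer_le
  proof (intro allI impI)
    fix d :: real assume d: "0 < d"
    \<comment> \<open>The constant is 44 = 40 + 4: with threshold \<open>e / 4\<close> the maximal
      inequality contributes \<open>40 / e\<close> times the L1 error and Markov's inequality
      \<open>4 / e\<close> times it, in total \<open>d\<close>.\<close>
    obtain k where k: "continuous_on UNIV k" and kC: "\<And>x. \<bar>k x\<bar> \<le> \<bar>C\<bar>"
      and kd: "(LINT t|lebesgue_on {a..b}. \<bar>k t - f t\<bar>) < d * e / 44"
      using bounded_measurable_L1_approx_continuous[OF f C, of "d * e / 44"] d e by auto
    define h where "h = (\<lambda>t. if t \<in> {a..b} then k t - f t else 0)"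
    have kab: "k absolutely_integrable_on {a..b}"
      by (rule absolutely_integrable_continuous_real) (auto intro: continuous_on_subset[OF k])
    have hi: "h absolutely_integrable_on UNIV"
      unfolding h_def absolutely_integrable_restrict_UNIV using kab fab by (rule set_integral_diff(1))
    have hL: "integrable lebesgue (\<lambda>t. \<bar>h t\<bar>)"
      using integrable_abs[OF hi[unfolded set_integrable_def]] by simp
    have "(LINT t|lebesgue. \<bar>h t\<bar>) = (LINT t|lebesgue_on {a..b}. \<bar>k t - f t\<bar>)"
      by (subst integral_restrict_space) (auto intro!: Bochner_Integration.integral_cong simp: h_def indicator_def)
    with kd have hd: "(LINT t|lebesgue. \<bar>h t\<bar>) < d * e / 44" by simp
    have "integral UNIV (\<lambda>t. \<bar>h t\<bar>) = (LINT t|lebesgue. \<bar>h t\<bar>)"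
      using set_lebesgue_integral_eq_integral(2)[of UNIV "\<lambda>t. \<bar>h t\<bar>"] hL
      by (simp add: set_integrable_def set_lebesgue_integral_def)
    with hd have hd': "integral UNIV (\<lambda>t. \<bar>h t\<bar>) < d * e / 44" by simp
    from e have "0 < e / 4" by simp
    from maximal_inequality_real[OF hi this] obtain W where W: "W \<in> lmeasurable"
      "measure lebesgue W \<le> 10 / (e / 4) * integral UNIV (\<lambda>t. \<bar>h t\<bar>)"
      "\<And>x r. 0 < r \<Longrightarrow> e / 4 * r < integral (cball x r) (\<lambda>t. \<bar>h t\<bar>) \<Longrightarrow> x \<in> W" by blast
    define V where "V = {x. \<bar>h x\<bar> \<ge> e / 4}"
    have Ve: "emeasure lebesgue V \<le> ennreal (1 / (e / 4) * (LINT t|lebesgue. \<bar>h t\<bar>))"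
      using integral_Markov_inequality[OF hL _ \<open>0 < e / 4\<close>] unfolding V_def by simp
    have "(\<lambda>t. \<bar>h t\<bar>) \<in> borel_measurable lebesgue" using hL by simp
    then have "V \<in> sets lebesgue" unfolding V_def
      using borel_measurable_le[of "\<lambda>_. e / 4" lebesgue "\<lambda>t. \<bar>h t\<bar>"] by simp
    then have V: "V \<in> lmeasurable" using Ve by (auto intro!: fmeasurableI simp: order_le_less_trans)
    have Vm: "measure lebesgue V \<le> 1 / (e / 4) * (LINT t|lebesgue. \<bar>h t\<bar>)"
      unfolding measure_def using e by (intro enn2real_leI[OF _ Ve] mult_nonneg_nonneg) auto
    have "measure lebesgue (W \<union> V) \<le> measure lebesgue W + measure lebesgue V"
      using W(1) V by (intro measure_Un_le) auto
    also have "\<dots> \<le> 10 / (e / 4) * (d * e / 44) + 1 / (e / 4) * (d * e / 44)"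
      using e hd hd' by (intro add_mono order.trans[OF W(2)] order.trans[OF Vm] mult_left_mono) auto
    also have "\<dots> = d" using e by (simp add: field_simps)
    finally have WV: "measure lebesgue (W \<union> V) \<le> d" .
    have "Q e x" if x: "x \<in> {a..b}" "x \<notin> W" "x \<notin> V" for x
    proof -
      have kx: "\<bar>k x - f x\<bar> \<le> e / 4" using x by (simp add: V_def h_def not_le less_imp_le)
      have "isCont k x" using k by (simp add: continuous_on_eq_continuous_at)
      then obtain \<delta> where \<delta>: "\<delta> > 0" "\<And>y. \<bar>y - x\<bar> < \<delta> \<Longrightarrow> \<bar>k y - k x\<bar> < e / 4"
        using \<open>0 < e / 4\<close> unfolding continuous_at_eps_delta dist_real_def by meson
      \<comment> \<open>As \<open>x\<close> is an endpoint, \<open>{s..t}\<close> lies in the ball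
        of radius \<open>t - s\<close> about \<open>x\<close>, where the maximal inequality applies.
        It costs one quarter of \<open>e\<close>, the deviation of \<open>k\<close> two
        more.\<close>
      have main: "\<bar>integral {s..t} f - f x * (t - s)\<bar> \<le> e * (t - s)"
        if st: "a \<le> s" "s < t" "t \<le> b" "t - s < \<delta>" and xs: "x = s \<or> x = t" for s t
      proof -
        have "\<bar>integral {s..t} f - f x * (t - s)\<bar>
            \<le> integral {s..t} (\<lambda>y. \<bar>k y - f y\<bar>) + 2 * (e / 4) * (t - s)"
        proof (rule integral_deviation_bound[where x = x])
          show "\<bar>k y - k x\<bar> \<le> e / 4" if "y \<in> {s..t}" for y
            using that st xs by (intro less_imp_le \<delta>) auto
        qed (use st xs kx k fst in auto)
        also have "integral {s..t} (\<lambda>y. \<bar>k y - f y\<bar>) = integral {s..t} (\<lambda>y. \<bar>h y\<bar>)"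
          using st by (intro integral_cong) (auto simp: h_def)
        also have "\<dots> \<le> integral (cball x (t - s)) (\<lambda>y. \<bar>h y\<bar>)"
        proof (rule integral_subset_le)
          have *: "(\<lambda>y. \<bar>h y\<bar>) absolutely_integrable_on UNIV"
            using hL by (simp add: set_integrable_def)
          show "(\<lambda>y. \<bar>h y\<bar>) integrable_on {s..t}" "(\<lambda>y. \<bar>h y\<bar>) integrable_on cball x (t - s)"
            by (rule set_lebesgue_integral_eq_integral(1), rule set_integrable_subset[OF *], auto)+
        qed (use xs st in \<open>auto simp: dist_real_def\<close>)
        also have "\<dots> \<le> e / 4 * (t - s)"
          using W(3)[of "t - s" x] x(2) st by force
        also have "e / 4 * (t - s) + 2 * (e / 4) * (t - s) \<le> e * (t - s)"
          using e st by (simp add: field_simps)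
        finally show ?thesis by simp
      qed
      show ?thesis unfolding Q_def
      proof (intro exI[of _ \<delta>] conjI ballI impI \<delta>(1))
        fix y assume y: "y \<in> {a..b}" "\<bar>y - x\<bar> < \<delta>"
        consider "y = x" | "y < x" | "x < y" by linarith
        then show "\<bar>F y - F x - f x * (y - x)\<bar> \<le> e * \<bar>y - x\<bar>"
        proof cases
          case 2
          have "\<bar>F y - F x - f x * (y - x)\<bar> = \<bar>integral {y..x} f - f x * (x - y)\<bar>"
            using Fdiff[of y x] y x 2 by (simp add: algebra_simps abs_minus_commute)
          then show ?thesis using main[of y x] y x 2 by simp
        next
          case 3
          then show ?thesis using Fdiff[of x y] main[of x y] y x by simp
        qed simp
      qed
    qed
    then have "E e \<subseteq> W \<union> V" by (auto simp: E_def)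
    then show "\<exists>S. E e \<subseteq> S \<and> S \<in> lmeasurable \<and> measure lebesgue S \<le> d"
      using WV W(1) V by (intro exI[of _ "W \<union> V"]) auto
  qed
  \<comment> \<open>The countably many tolerances \<open>1 / Suc n\<close> suffice for the
    derivative, so a single null set serves all of them.\<close>
  have "negligible (\<Union>n. E (1 / Suc n))"
    by (intro negligible_countable_Union) (auto intro!: negE)
  then have "AE x in lebesgue. x \<notin> (\<Union>n. E (1 / Suc n))"
    by (intro AE_not_in) (simp only: negligible_iff_null_sets)
  then have "AE x in lebesgue_on {a..b}. x \<notin> (\<Union>n. E (1 / Suc n))"
    by (subst AE_restrict_space_iff) (auto elim: AE_mp)
  then show ?thesis
    unfolding F_def[symmetric]
    using AE_space
  proof eventually_elim
    case (elim x)
    then have x: "x \<in> {a..b}" and Qn: "\<And>n. Q (1 / Suc n) x" by (auto simp: E_def)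
    have "(F has_derivative (\<lambda>y. f x * y)) (at x within {a..b})"
      unfolding has_derivative_within_alt
    proof (intro conjI allI impI bounded_linear_mult_right)
      fix e :: real assume "0 < e"
      then obtain n where n: "1 / Suc n < e" using nat_approx_posE by (metis of_nat_Suc)
      from Qn[of n] obtain \<delta> where \<delta>: "\<delta> > 0"
        "\<And>y. y \<in> {a..b} \<Longrightarrow> \<bar>y - x\<bar> < \<delta> \<Longrightarrow> \<bar>F y - F x - f x * (y - x)\<bar> \<le> 1 / Suc n * \<bar>y - x\<bar>"
        unfolding Q_def by blast
      have "norm (F y - F x - f x * (y - x)) \<le> e * norm (y - x)"
        if "y \<in> {a..b}" "norm (y - x) < \<delta>" for y
        using order.trans[OF \<delta>(2) mult_right_mono[OF less_imp_le[OF n] abs_ge_zero]] that by simp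
      then show "\<exists>d>0. \<forall>y\<in>{a..b}. norm (y - x) < d \<longrightarrow> norm (F y - F x - f x * (y - x)) \<le> e * norm (y - x)"
        using \<delta>(1) by blast
    qed
    then show ?case by (simp add: has_field_derivative_def)
  qed
qed

section \<open>Young measures\<close>

lemma finite_measure_lebesgue_on_Icc: "finite_measure (lebesgue_on {a..b::real})"
  by (rule finite_measure_lebesgue_on) simp

text \<open>Needed to unfold the monadic bind in \<open>young_assoc\<close>. Pairing with the time
  is jointly measurable because the Lebesgue sigma-algebra in time contains the Borel one.\<close>

lemma young_kernel_measurable:
  fixes \<mu> :: "real \<Rightarrow> 'a::euclidean_space measure"
  assumes "young_measure T \<mu>"
  shows "(\<lambda>\<tau>. distr (\<mu> \<tau>) (restrict_space borel ({0..T} \<times> UNIV)) (Pair \<tau>))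
    \<in> lebesgue_on {0..T} \<rightarrow>\<^sub>M subprob_algebra (restrict_space borel ({0..T} \<times> UNIV))"
proof (rule measurable_distr2)
  show "\<mu> \<in> lebesgue_on {0..T} \<rightarrow>\<^sub>M subprob_algebra borel"
    using assms unfolding young_measure_def by (rule measurable_prob_algebraD)
  have "(\<lambda>x. x) \<in> lebesgue_on {0..T} \<rightarrow>\<^sub>M borel"
    by (rule continuous_imp_measurable_on_sets_lebesgue) auto
  then have "(\<lambda>p. (fst p, snd p)) \<in> lebesgue_on {0..T} \<Otimes>\<^sub>M (borel :: 'a measure) \<rightarrow>\<^sub>M borel \<Otimes>\<^sub>M borel"
    by (intro measurable_Pair measurable_compose[OF measurable_fst] measurable_snd)
  then show "(\<lambda>(x, y). (x, y)) \<in> lebesgue_on {0..T} \<Otimes>\<^sub>M (borel :: 'a measure) \<rightarrow>\<^sub>M restrict_space borel ({0..T} \<times> UNIV)"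
    by (intro measurable_restrict_space2) (auto simp: borel_prod[symmetric] space_pair_measure split_beta)
qed

text \<open>A Fubini statement: the integral over the mixture of the fibres is the time integral of
  the fibre integrals. Boundedness of \<open>f\<close> and finiteness of the time interval supply
  the integrability that the join of measures requires.\<close>

lemma
  fixes \<mu> :: "real \<Rightarrow> 'a::euclidean_space measure"
  assumes T: "0 < T" and \<mu>: "young_measure T \<mu>"
    and f: "continuous_on ({0..T} \<times> UNIV) f" and C: "\<And>\<tau> V. \<tau> \<in> {0..T} \<Longrightarrow> \<bar>f (\<tau>, V) :: real\<bar> \<le> C"
  shows integral_young_assoc:
      "(\<integral>p. f p \<partial>young_assoc T \<mu>) = (\<integral>\<tau>. (\<integral>V. f (\<tau>, V) \<partial>\<mu> \<tau>) \<partial>lebesgue_on {0..T})" (is ?eq)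
    and integral_young_measurable:
      "(\<lambda>\<tau>. \<integral>V. f (\<tau>, V) \<partial>\<mu> \<tau>) \<in> borel_measurable (lebesgue_on {0..T})" (is ?meas)
proof -
  let ?L = "lebesgue_on {0..T}" and ?R = "restrict_space borel ({0..T} \<times> UNIV) :: (real \<times> 'a) measure"
  let ?k = "\<lambda>\<tau>. distr (\<mu> \<tau>) ?R (Pair \<tau>)"
  note k = young_kernel_measurable[OF \<mu>]
  have fR: "f \<in> borel_measurable ?R"
    by (rule borel_measurable_continuous_on_restrict[OF f])
  have k': "integral\<^sup>L (?k \<tau>) f = (\<integral>V. f (\<tau>, V) \<partial>\<mu> \<tau>)" if "\<tau> \<in> {0..T}" for \<tau>
  proof (rule integral_distr[OF _ fR])
    have "sets (\<mu> \<tau>) = sets borel"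
      using \<mu> that by (intro sets_kernel[OF measurable_prob_algebraD]) (auto simp: young_measure_def)
    moreover have "Pair \<tau> \<in> borel_measurable (borel :: 'a measure)"
      by (intro borel_measurable_continuous_onI continuous_intros)
    ultimately show "Pair \<tau> \<in> \<mu> \<tau> \<rightarrow>\<^sub>M ?R"
      using that by (intro measurable_restrict_space2) (auto cong: measurable_cong_sets)
  qed
  have "(\<lambda>\<tau>. integral\<^sup>L (?k \<tau>) f) \<in> borel_measurable ?L"
    by (rule measurable_compose[OF k integral_measurable_subprob_algebra[OF fR]])
  then show ?meas
    by (rule measurable_cong[THEN iffD1, rotated]) (use k' in auto)
  \<comment> \<open>Unfolding the bind into a join requires a nonempty base space.\<close>
  have ne: "space ?L \<noteq> {}" using T by auto
  have "(\<integral>p. f p \<partial>young_assoc T \<mu>) = (\<integral>M. integral\<^sup>L M f \<partial>distr ?L (subprob_algebra ?R) ?k)"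
    unfolding young_assoc_def bind_nonempty''[OF k ne]
  proof (rule integral_join[where B = C and B' = 1])
    show "\<And>x. x \<in> space ?R \<Longrightarrow> \<bar>f x\<bar> \<le> C"
      using C by (auto simp: space_restrict_space)
    show "finite_measure (distr ?L (subprob_algebra ?R) ?k)"
      by (rule finite_measure.finite_measure_distr[OF finite_measure_lebesgue_on_Icc k])
    have "emeasure M' (space M') \<le> 1" if "M' \<in> space (subprob_algebra ?R)" for M'
      using that by (simp add: space_subprob_algebra subprob_space.emeasure_space_le_1)
    then show "AE M' in distr ?L (subprob_algebra ?R) ?k. emeasure M' (space M') \<le> ennreal 1"
      by (intro AE_I2) simp
  qed (use fR in auto)
  also have "\<dots> = (\<integral>\<tau>. integral\<^sup>L (?k \<tau>) f \<partial>?L)"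
    by (rule integral_distr[OF k integral_measurable_subprob_algebra[OF fR]])
  also have "\<dots> = (\<integral>\<tau>. (\<integral>V. f (\<tau>, V) \<partial>\<mu> \<tau>) \<partial>?L)"
    by (rule Bochner_Integration.integral_cong) (use k' in auto)
  finally show ?eq .
qed

lemma young_measure_dirac:
  assumes "continuous_on {0..T} X"
  shows "young_measure T (dirac_young X)"
proof -
  have "X \<in> lebesgue_on {0..T} \<rightarrow>\<^sub>M borel"
    by (rule continuous_imp_measurable_on_sets_lebesgue[OF assms]) simp
  then show ?thesis
    unfolding young_measure_def dirac_young_def
    by (rule measurable_compose[OF _ measurable_return_prob_space])
qed

text \<open>Integration against a Dirac fibre is evaluation along the curve, so Young convergence
  becomes convergence of ordinary time integrals.\<close>

lemma young_conv_diracD: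
  fixes X :: "nat \<Rightarrow> real \<Rightarrow> 'a::euclidean_space"
  assumes T: "0 < T" and X: "\<And>i. continuous_on {0..T} (X i)" and \<mu>: "young_measure T \<mu>"
    and conv: "young_conv T (\<lambda>i. dirac_young (X i)) \<mu>"
    and f: "continuous_on ({0..T} \<times> UNIV) f" and C: "\<And>\<tau> V. \<tau> \<in> {0..T} \<Longrightarrow> \<bar>f (\<tau>, V) :: real\<bar> \<le> C"
  shows "(\<lambda>i. \<integral>\<tau>. f (\<tau>, X i \<tau>) \<partial>lebesgue_on {0..T}) \<longlonglongrightarrow>
    (\<integral>\<tau>. (\<integral>V. f (\<tau>, V) \<partial>\<mu> \<tau>) \<partial>lebesgue_on {0..T})"
proof -
  have "bounded (f ` ({0..T} \<times> UNIV))"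
    using C by (auto simp: bounded_iff intro!: exI[of _ C])
  then have "(\<lambda>i. \<integral>p. f p \<partial>young_assoc T (dirac_young (X i))) \<longlonglongrightarrow> (\<integral>p. f p \<partial>young_assoc T \<mu>)"
    using conv f unfolding young_conv_def weak_measure_conv_def by blast
  moreover have "(\<integral>V. f (\<tau>, V) \<partial>dirac_young (X i) \<tau>) = f (\<tau>, X i \<tau>)" if "\<tau> \<in> {0..T}" for i \<tau>
  proof -
    have "continuous_on UNIV (\<lambda>V. f (\<tau>, V))"
      by (rule continuous_on_compose2[OF f]) (use that in \<open>auto intro!: continuous_intros\<close>)
    then show ?thesis
      unfolding dirac_young_def by (intro integral_return) (auto intro: borel_measurable_continuous_onI)
  qed
  then have "(\<integral>p. f p \<partial>young_assoc T (dirac_young (X i))) = (\<integral>\<tau>. f (\<tau>, X i \<tau>) \<partial>lebesgue_on {0..T})" for i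
    by (subst integral_young_assoc[OF T young_measure_dirac[OF X] f C])
      (auto intro!: Bochner_Integration.integral_cong)
  ultimately show ?thesis
    using integral_young_assoc[OF T \<mu> f C] by simp
qed

section \<open>Concentration properties of a limit Young measure\<close>

lemma young_measureD:
  assumes "young_measure T \<mu>" "\<tau> \<in> {0..T}"
  shows "prob_space (\<mu> \<tau>)" "sets (\<mu> \<tau>) = sets borel"
  using measurable_space[of \<mu> "lebesgue_on {0..T}" "prob_algebra borel" \<tau>] assms
  by (auto simp: young_measure_def space_prob_algebra)

lemma integrable_on_Icc_bounded:
  fixes G :: "real \<Rightarrow> real"
  assumes "G \<in> borel_measurable (lebesgue_on {a..b})" "\<And>x. x \<in> {a..b} \<Longrightarrow> \<bar>G x\<bar> \<le> C"
  shows "integrable (lebesgue_on {a..b}) G"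
  using assms
  by (intro finite_measure.integrable_const_bound[where B=C] finite_measure_lebesgue_on_Icc AE_I2) auto

lemma young_integral_bound:
  assumes \<mu>: "young_measure T \<mu>" and \<tau>: "\<tau> \<in> {0..T}" and C: "\<And>V. \<bar>g V :: real\<bar> \<le> C"
  shows "\<bar>\<integral>V. g V \<partial>\<mu> \<tau>\<bar> \<le> C"
proof -
  interpret prob_space "\<mu> \<tau>" by (rule young_measureD[OF \<mu> \<tau>])
  have "\<bar>\<integral>V. g V \<partial>\<mu> \<tau>\<bar> \<le> (\<integral>V. \<bar>g V\<bar> \<partial>\<mu> \<tau>)"
    using integral_norm_bound[of "\<mu> \<tau>" g] by simp
  also have "\<dots> \<le> (\<integral>V. C \<partial>\<mu> \<tau>)"
  proof (rule integral_mono')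
    show "0 \<le> C" using C[of undefined] by linarith
  qed (use C in auto)
  also have "\<dots> = C" by (simp add: prob_space)
  finally show ?thesis .
qed

text \<open>The limiting double integral is zero by uniqueness of limits. For a nonnegative
  integrand this forces first the inner integral to vanish for almost every time, then the integrand
  itself almost everywhere in the fibre.\<close>

lemma young_limit_zero_AE:
  fixes X :: "nat \<Rightarrow> real \<Rightarrow> 'a::euclidean_space"
  assumes T: "0 < T" and X: "\<And>i. continuous_on {0..T} (X i)" and \<mu>: "young_measure T \<mu>"
    and conv: "young_conv T (\<lambda>i. dirac_young (X i)) \<mu>"
    and f: "continuous_on ({0..T} \<times> UNIV) f"
    and C: "\<And>\<tau> V. \<tau> \<in> {0..T} \<Longrightarrow> 0 \<le> f (\<tau>, V) \<and> f (\<tau>, V) \<le> (C :: real)"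
    and lim: "(\<lambda>i. \<integral>\<tau>. f (\<tau>, X i \<tau>) \<partial>lebesgue_on {0..T}) \<longlonglongrightarrow> 0"
  shows "AE \<tau> in lebesgue_on {0..T}. AE V in \<mu> \<tau>. f (\<tau>, V) = 0"
proof -
  let ?L = "lebesgue_on {0..T}"
  have C': "\<And>\<tau> V. \<tau> \<in> {0..T} \<Longrightarrow> \<bar>f (\<tau>, V)\<bar> \<le> C" using C by auto
  have int: "integrable ?L (\<lambda>\<tau>. \<integral>V. f (\<tau>, V) \<partial>\<mu> \<tau>)"
    using young_integral_bound[OF \<mu> _ C']
    by (intro integrable_on_Icc_bounded[OF integral_young_measurable[OF T \<mu> f C']])
  have "(\<integral>\<tau>. (\<integral>V. f (\<tau>, V) \<partial>\<mu> \<tau>) \<partial>?L) = 0"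
    using LIMSEQ_unique[OF young_conv_diracD[OF T X \<mu> conv f C'] lim] .
  then have "AE \<tau> in ?L. (\<integral>V. f (\<tau>, V) \<partial>\<mu> \<tau>) = 0"
    using C by (subst (asm) integral_nonneg_eq_0_iff_AE[OF int])
      (auto intro!: AE_I2 Bochner_Integration.integral_nonneg)
  then show ?thesis using AE_space
  proof eventually_elim
    case (elim \<tau>)
    then have \<tau>: "\<tau> \<in> {0..T}" by simp
    interpret prob_space "\<mu> \<tau>" by (rule young_measureD[OF \<mu> \<tau>])
    have "continuous_on UNIV (\<lambda>V. f (\<tau>, V))"
      by (rule continuous_on_compose2[OF f]) (use \<tau> in \<open>auto intro!: continuous_intros\<close>)
    then have "(\<lambda>V. f (\<tau>, V)) \<in> borel_measurable (\<mu> \<tau>)"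
      using young_measureD(2)[OF \<mu> \<tau>]
      by (auto cong: measurable_cong_sets intro: borel_measurable_continuous_onI)
    then have "integrable (\<mu> \<tau>) (\<lambda>V. f (\<tau>, V))"
      using C'[OF \<tau>] by (intro integrable_const_bound[where B=C]) auto
    from integral_nonneg_eq_0_iff_AE[OF this] elim(1) C[OF \<tau>] show ?case by simp
  qed
qed

text \<open>Test with the distance to \<open>S\<close> truncated at 1: it is bounded and continuous,
  vanishes along the curves, and has zero set exactly \<open>S\<close> because \<open>S\<close> is
  closed and nonempty.\<close>

lemma young_concentrated_AE:
  fixes X :: "nat \<Rightarrow> real \<Rightarrow> 'a::euclidean_space"
  assumes T: "0 < T" and X: "\<And>i. continuous_on {0..T} (X i)" and \<mu>: "young_measure T \<mu>"
    and conv: "young_conv T (\<lambda>i. dirac_young (X i)) \<mu>"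
    and S: "closed S" and XS: "\<And>i \<tau>. \<tau> \<in> {0..T} \<Longrightarrow> X i \<tau> \<in> S"
  shows "AE \<tau> in lebesgue_on {0..T}. AE V in \<mu> \<tau>. V \<in> S"
proof -
  have ne: "S \<noteq> {}" using XS[of 0] T by auto
  define f where "f = (\<lambda>p :: real \<times> 'a. min 1 (infdist (snd p) S))"
  have "(\<integral>\<tau>. f (\<tau>, X i \<tau>) \<partial>lebesgue_on {0..T}) = (\<integral>\<tau>. 0 \<partial>lebesgue_on {0..T})" for i
    using XS by (intro Bochner_Integration.integral_cong) (auto simp: f_def)
  then have "AE \<tau> in lebesgue_on {0..T}. AE V in \<mu> \<tau>. f (\<tau>, V) = 0"
    by (intro young_limit_zero_AE[OF T X \<mu> conv, where C = 1])
      (auto simp: f_def infdist_nonneg intro!: continuous_intros)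
  then show ?thesis
    by eventually_elim
      (use in_closed_iff_infdist_zero[OF S ne] in \<open>auto simp: f_def min_def split: if_splits\<close>)
qed

section \<open>Averaging of slow observables along a Young-convergent sequence\<close>

text \<open>Young convergence only admits continuous test functions, so the indicator of the
  interval up to \<tau> is replaced by a ramp that falls from 1 to 0 between \<tau> and \<tau> +
  \<open>d\<close>. The two differ only on that interval of length \<open>d\<close>.\<close>

lemma cutoff_integral_approx:
  fixes G :: "real \<Rightarrow> real"
  assumes G: "G \<in> borel_measurable (lebesgue_on {0..T})" and C: "\<And>x. x \<in> {0..T} \<Longrightarrow> \<bar>G x\<bar> \<le> C"
    and d: "0 < d" and \<tau>: "\<tau> \<in> {0..T}"
  shows "\<bar>(\<integral>s. max 0 (min 1 ((\<tau> + d - s) / d)) * G s \<partial>lebesgue_on {0..T}) - integral {0..\<tau>} G\<bar> \<le> C * d"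
proof -
  let ?L = "lebesgue_on {0..T}" and ?\<phi> = "\<lambda>s. max 0 (min 1 ((\<tau> + d - s) / d))"
  have C0: "0 \<le> C" using C[OF \<tau>] by linarith
  note GI = integrable_on_Icc_bounded[OF G C]
  have \<phi>: "?\<phi> \<in> borel_measurable ?L"
    by (rule continuous_imp_measurable_on_sets_lebesgue) (use d in \<open>auto intro!: continuous_intros\<close>)
  have I: "indicat_real A \<in> borel_measurable ?L" if "A \<in> sets borel" for A
    using that by (intro measurable_restrict_space1 borel_measurable_indicator) auto
  have i1: "integrable ?L (\<lambda>s. ?\<phi> s * G s)"
  proof (rule integrable_on_Icc_bounded[where C = C])
    show "\<bar>?\<phi> x * G x\<bar> \<le> C" if "x \<in> {0..T}" for x
      using mult_mono[of "\<bar>?\<phi> x\<bar>" 1 "\<bar>G x\<bar>" C] C[OF that] by (auto simp: abs_mult)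
  qed (use \<phi> G in auto)
  have i2: "integrable ?L (\<lambda>s. indicat_real {0..\<tau>} s * G s)"
  proof (rule integrable_on_Icc_bounded[where C = C])
    show "\<bar>indicat_real {0..\<tau>} x * G x\<bar> \<le> C" if "x \<in> {0..T}" for x
      using C[OF that] C0 by (auto simp: indicator_def)
  qed (use I G in auto)
  have i3: "integrable ?L (\<lambda>s. C * indicat_real {\<tau>..\<tau> + d} s)"
  proof (rule integrable_on_Icc_bounded[where C = C])
    show "(\<lambda>s. C * indicat_real {\<tau>..\<tau> + d} s) \<in> borel_measurable ?L"
      by (intro borel_measurable_times borel_measurable_const I) simp
  qed (use C0 in \<open>auto simp: indicator_def\<close>)
  have "integral {0..\<tau>} G = (LINT s:{0..\<tau>}|lebesgue. G s)"
  proof (rule set_lebesgue_integral_eq_integral(2)[symmetric])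
    have "G absolutely_integrable_on {0..T}"
      using GI by (simp add: set_integrable_def integrable_restrict_space)
    then show "G absolutely_integrable_on {0..\<tau>}"
      by (rule set_integrable_subset) (use \<tau> in auto)
  qed
  also have "\<dots> = (\<integral>s. indicat_real {0..\<tau>} s * G s \<partial>?L)"
    unfolding set_lebesgue_integral_def using \<tau>
    by (subst integral_restrict_space) (auto intro!: Bochner_Integration.integral_cong simp: indicator_def)
  finally have "(\<integral>s. ?\<phi> s * G s \<partial>?L) - integral {0..\<tau>} G
      = (\<integral>s. ?\<phi> s * G s - indicat_real {0..\<tau>} s * G s \<partial>?L)"
    using i1 i2 by simp
  also have "\<bar>\<dots>\<bar> \<le> (\<integral>s. C * indicat_real {\<tau>..\<tau> + d} s \<partial>?L)"
  proof -
    have "norm (?\<phi> s * G s - indicat_real {0..\<tau>} s * G s) \<le> C * indicat_real {\<tau>..\<tau> + d} s"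
      if s: "s \<in> {0..T}" for s
    proof -
      have "\<bar>?\<phi> s - indicat_real {0..\<tau>} s\<bar> \<le> indicat_real {\<tau>..\<tau> + d} s"
        using d s by (auto simp: indicator_def field_simps max_def min_def)
      then have "\<bar>?\<phi> s - indicat_real {0..\<tau>} s\<bar> * \<bar>G s\<bar> \<le> indicat_real {\<tau>..\<tau> + d} s * C"
        using C[OF s] by (intro mult_mono) auto
      then show ?thesis by (simp only: left_diff_distrib[symmetric] abs_mult mult.commute[of C] real_norm_def)
    qed
    then have "(\<integral>s. norm (?\<phi> s * G s - indicat_real {0..\<tau>} s * G s) \<partial>?L) \<le> (\<integral>s. C * indicat_real {\<tau>..\<tau> + d} s \<partial>?L)"
      using i1 i2 i3 by (intro integral_mono integrable_norm Bochner_Integration.integrable_diff) auto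
    with integral_norm_bound[of ?L "\<lambda>s. ?\<phi> s * G s - indicat_real {0..\<tau>} s * G s"]
    have "norm (\<integral>s. ?\<phi> s * G s - indicat_real {0..\<tau>} s * G s \<partial>?L) \<le> (\<integral>s. C * indicat_real {\<tau>..\<tau> + d} s \<partial>?L)"
      by (rule order.trans)
    then show ?thesis by simp
  qed
  also have "\<dots> = C * measure lebesgue ({\<tau>..\<tau> + d} \<inter> {0..T})"
    using I by (simp add: measure_restrict_space Int_commute)
  also have "\<dots> \<le> C * measure lebesgue {\<tau>..\<tau> + d}"
    using C0 by (intro mult_left_mono measure_mono_fmeasurable) auto
  also have "\<dots> = C * d" using d by simp
  finally show ?thesis .
qed

text \<open>An interchange of limits: the approximation error is uniform in \<open>n\<close>, so
  three errors of at most a quarter of the target accuracy add up to less than it.\<close>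

lemma tendsto_approximants:
  fixes x :: "nat \<Rightarrow> real"
  assumes "\<And>e. 0 < e \<Longrightarrow> \<exists>y l. y \<longlonglongrightarrow> l \<and> (\<forall>n. \<bar>y n - x n\<bar> \<le> e) \<and> \<bar>l - L\<bar> \<le> e"
  shows "x \<longlonglongrightarrow> L"
proof (rule LIMSEQ_I)
  fix r :: real assume "0 < r"
  then have "0 < r / 4" by simp
  from assms[OF this] obtain y l where y: "y \<longlonglongrightarrow> l" "\<And>n. \<bar>y n - x n\<bar> \<le> r / 4" "\<bar>l - L\<bar> \<le> r / 4"
    by blast
  from LIMSEQ_D[OF y(1) \<open>0 < r / 4\<close>] obtain m where m: "\<And>n. n \<ge> m \<Longrightarrow> norm (y n - l) < r / 4" by blast
  have "norm (x n - L) < r" if "n \<ge> m" for n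
    using m[OF that] y(2)[of n] y(3) \<open>0 < r\<close> unfolding real_norm_def by linarith
  then show "\<exists>m. \<forall>n\<ge>m. norm (x n - L) < r" by blast
qed

text \<open>The averaging argument freed from the particular equation. All it uses of the dynamics
  is a common compact box and that the time derivative of \<open>q\<close> is one fixed continuous
  function \<open>F\<close> of the state, the same for every index.\<close>

theorem slow_observable_young_limit:
  fixes X :: "nat \<Rightarrow> real \<Rightarrow> 'a::euclidean_space" and q F :: "'a \<Rightarrow> real"
  assumes T: "0 < T" and X: "\<And>i. continuous_on {0..T} (X i)" and \<mu>: "young_measure T \<mu>"
    and conv: "young_conv T (\<lambda>i. dirac_young (X i)) \<mu>"
    and XB: "\<And>i \<tau>. \<tau> \<in> {0..T} \<Longrightarrow> X i \<tau> \<in> cbox l u"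
    and q: "continuous_on (cbox l u) q" and F: "continuous_on (cbox l u) F"
    and qF: "\<And>i \<tau>. \<tau> \<in> {0..T} \<Longrightarrow>
      ((\<lambda>t. q (X i t)) has_real_derivative F (X i \<tau>)) (at \<tau> within {0..T})"
  obtains v C where "\<And>s t. s \<in> {0..T} \<Longrightarrow> t \<in> {0..T} \<Longrightarrow> \<bar>v t - v s\<bar> \<le> C * \<bar>t - s\<bar>"
    "\<And>\<tau>. \<tau> \<in> {0..T} \<Longrightarrow> (\<lambda>i. q (X i \<tau>)) \<longlonglongrightarrow> v \<tau>"
    "AE \<tau> in lebesgue_on {0..T}. AE V in \<mu> \<tau>. V \<in> cbox l u \<and> q V = v \<tau>"
    "AE \<tau> in lebesgue_on {0..T}.
      (v has_real_derivative (\<integral>V. ext_cont F l u V \<partial>\<mu> \<tau>)) (at \<tau> within {0..T})"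
proof -
  let ?L = "lebesgue_on {0..T}"
  \<comment> \<open>Test functions must be defined and bounded on the whole space, while
    \<open>q\<close> and \<open>F\<close> are controlled only on the box; \<open>ext_cont\<close>
    extends them by clamping the argument to the box.\<close>
  define q' F' where "q' = ext_cont q l u" and "F' = ext_cont F l u"
  have q'c: "continuous_on S q'" and F'c: "continuous_on S F'" for S
    unfolding q'_def F'_def by (intro continuous_on_ext_cont q F)+
  have q'X: "q' (X i \<tau>) = q (X i \<tau>)" and F'X: "F' (X i \<tau>) = F (X i \<tau>)" if "\<tau> \<in> {0..T}" for i \<tau>
    using XB[OF that] by (simp_all add: q'_def F'_def)
  have "bounded (range q')" "bounded (range F')"
    unfolding q'_def F'_def ext_cont_def
    by (intro clamp_bounded compact_imp_bounded compact_continuous_image q F compact_cbox)+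
  then obtain Cq C where Cq: "\<And>V. \<bar>q' V\<bar> \<le> Cq" and C: "\<And>V. \<bar>F' V\<bar> \<le> C"
    by (auto simp: bounded_iff)
  have C0: "0 \<le> C" using C[of undefined] by linarith
  define g where "g = (\<lambda>\<tau>. \<integral>V. F' V \<partial>\<mu> \<tau>)"
  have "continuous_on ({0..T} \<times> UNIV) (\<lambda>p. F' (snd p))"
    by (rule continuous_on_compose2[OF F'c[of UNIV]]) (auto intro!: continuous_intros)
  then have gm: "g \<in> borel_measurable ?L"
    using integral_young_measurable[OF T \<mu>, of "\<lambda>p. F' (snd p)" C] C by (simp add: g_def)
  have gC: "\<bar>g \<tau>\<bar> \<le> C" if "\<tau> \<in> {0..T}" for \<tau>
    unfolding g_def using young_integral_bound[OF \<mu> that C] .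
  define w where "w = (\<lambda>i \<tau>. q (X i \<tau>))"
  have wb: "\<bar>w i \<tau>\<bar> \<le> Cq" if "\<tau> \<in> {0..T}" for i \<tau>
    using Cq[of "X i \<tau>"] q'X[OF that] by (simp add: w_def)
  have wc: "continuous_on {0..T} (w i)" for i
    unfolding w_def using qF by (intro DERIV_continuous_on)
  have wm: "w i \<in> borel_measurable ?L" for i
    by (rule continuous_imp_measurable_on_sets_lebesgue[OF wc]) simp
  \<comment> \<open>Mean value inequality; the constant bounds \<open>F\<close> on the whole box and
    is therefore the same for all \<open>i\<close>.\<close>
  have wlip: "\<bar>w i t - w i s\<bar> \<le> C * \<bar>t - s\<bar>" if "s \<in> {0..T}" "t \<in> {0..T}" for i s t
    using field_differentiable_bound[of "{0..T}" "w i" "\<lambda>\<tau>. F (X i \<tau>)" C t s] qF that C F'X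
    unfolding w_def by (metis real_norm_def convex_real_interval(5))
  have FXm: "(\<lambda>s. F' (X i s)) \<in> borel_measurable ?L" for i
    by (rule continuous_imp_measurable_on_sets_lebesgue)
      (auto intro: continuous_on_compose2[OF F'c[of UNIV] X])
  have ftc: "integral {0..\<tau>} (\<lambda>s. F' (X i s)) = w i \<tau> - w i 0" if \<tau>: "\<tau> \<in> {0..T}" for i \<tau>
  proof (rule integral_unique, rule fundamental_theorem_of_calculus)
    fix s assume s: "s \<in> {0..\<tau>}"
    then have "(w i has_real_derivative F' (X i s)) (at s within {0..T})"
      using qF[of s i] F'X[of s i] \<tau> by (simp add: w_def)
    then show "(w i has_vector_derivative F' (X i s)) (at s within {0..\<tau>})"
      using \<tau> by (auto simp: has_real_derivative_iff_has_vector_derivative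
        intro: has_vector_derivative_within_subset)
  qed (use \<tau> in simp)
  define \<Phi> where "\<Phi> = (\<lambda>\<tau>. integral {0..\<tau>} g)"
  have incr: "(\<lambda>i. w i \<tau> - w i 0) \<longlonglongrightarrow> \<Phi> \<tau>" if \<tau>: "\<tau> \<in> {0..T}" for \<tau>
  proof (rule tendsto_approximants)
    fix e :: real assume e: "0 < e"
    \<comment> \<open>The cutoff error is \<open>C * d\<close>; the added 1 keeps the quotient
      defined when \<open>C = 0\<close>.\<close>
    define d where "d = e / (C + 1)"
    have d: "0 < d" "C * d \<le> e" using e C0 by (auto simp: d_def field_simps)
    let ?\<phi> = "\<lambda>s. max 0 (min 1 ((\<tau> + d - s) / d))"
    have "(\<lambda>i. \<integral>s. ?\<phi> s * F' (X i s) \<partial>?L) \<longlonglongrightarrow> (\<integral>s. (\<integral>V. ?\<phi> s * F' V \<partial>\<mu> s) \<partial>?L)"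
    proof (rule young_conv_diracD[OF T X \<mu> conv, where f = "\<lambda>p. ?\<phi> (fst p) * F' (snd p)", simplified fst_conv snd_conv])
      show "continuous_on ({0..T} \<times> UNIV) (\<lambda>p. ?\<phi> (fst p) * F' (snd p))"
        using d by (auto intro!: continuous_intros continuous_on_compose2[OF F'c[of UNIV]])
      show "\<bar>?\<phi> s * F' V\<bar> \<le> C" for s V
        using mult_mono[of "\<bar>?\<phi> s\<bar>" 1 "\<bar>F' V\<bar>" C] C by (auto simp: abs_mult)
    qed
    then have "(\<lambda>i. \<integral>s. ?\<phi> s * F' (X i s) \<partial>?L) \<longlonglongrightarrow> (\<integral>s. ?\<phi> s * g s \<partial>?L)"
      by (simp add: g_def)
    moreover have "\<bar>(\<integral>s. ?\<phi> s * F' (X i s) \<partial>?L) - (w i \<tau> - w i 0)\<bar> \<le> e" for i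
      using cutoff_integral_approx[OF FXm[of i] C d(1) \<tau>] d(2) ftc[OF \<tau>, of i] by simp
    moreover have "\<bar>(\<integral>s. ?\<phi> s * g s \<partial>?L) - \<Phi> \<tau>\<bar> \<le> e"
      using cutoff_integral_approx[OF gm gC d(1) \<tau>] d(2) by (simp add: \<Phi>_def)
    ultimately show "\<exists>y l. y \<longlonglongrightarrow> l \<and> (\<forall>i. \<bar>y i - (w i \<tau> - w i 0)\<bar> \<le> e) \<and> \<bar>l - \<Phi> \<tau>\<bar> \<le> e"
      by blast
  qed
  have zero: "0 \<in> {0..T}" using T by simp
  have gi: "g integrable_on {0..T}"
  proof (rule set_lebesgue_integral_eq_integral(1))
    show "g absolutely_integrable_on {0..T}"
      using integrable_on_Icc_bounded[OF gm gC] by (simp add: set_integrable_def integrable_restrict_space)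
  qed
  have \<Phi>m: "\<Phi> \<in> borel_measurable ?L"
    unfolding \<Phi>_def
    by (rule continuous_imp_measurable_on_sets_lebesgue[OF indefinite_integral_continuous_1[OF gi]]) simp
  have constL: "integrable ?L (\<lambda>_. c)" for c :: real
    by (rule finite_measure.integrable_const[OF finite_measure_lebesgue_on_Icc])
  have "(\<lambda>i. \<integral>\<tau>. w i \<tau> - w i 0 \<partial>?L) \<longlonglongrightarrow> (\<integral>\<tau>. \<Phi> \<tau> \<partial>?L)"
  proof (rule integral_dominated_convergence[where w = "\<lambda>_. 2 * Cq"])
    show "AE \<tau> in ?L. norm (w i \<tau> - w i 0) \<le> 2 * Cq" for i
    proof (rule AE_I2)
      fix \<tau> assume "\<tau> \<in> space ?L"
      with wb[of \<tau> i] wb[OF zero, of i] show "norm (w i \<tau> - w i 0) \<le> 2 * Cq" by auto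
    qed
  qed (use wm \<Phi>m constL incr in \<open>auto intro!: AE_I2\<close>)
  moreover obtain a where "(\<lambda>i. \<integral>\<tau>. w i \<tau> \<partial>?L) \<longlonglongrightarrow> a"
  proof -
    have "continuous_on ({0..T} \<times> UNIV) (\<lambda>p. q' (snd p))"
      by (rule continuous_on_compose2[OF q'c[of UNIV]]) (auto intro!: continuous_intros)
    then have "(\<lambda>i. \<integral>\<tau>. q' (X i \<tau>) \<partial>?L) \<longlonglongrightarrow> (\<integral>\<tau>. (\<integral>V. q' V \<partial>\<mu> \<tau>) \<partial>?L)"
      using young_conv_diracD[OF T X \<mu> conv, where f = "\<lambda>p. q' (snd p)" and C = Cq] Cq by simp
    moreover have "(\<integral>\<tau>. q' (X i \<tau>) \<partial>?L) = (\<integral>\<tau>. w i \<tau> \<partial>?L)" for i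
      by (rule Bochner_Integration.integral_cong) (auto simp: w_def q'X)
    ultimately show thesis using that by simp
  qed
  \<comment> \<open>Subtracting the integrated increments leaves the constant \<open>w i 0\<close>
    integrated over an interval of length \<open>T\<close>, so this sequence is \<open>w i 0\<close>
    itself.\<close>
  ultimately have lim: "(\<lambda>i. ((\<integral>\<tau>. w i \<tau> \<partial>?L) - (\<integral>\<tau>. w i \<tau> - w i 0 \<partial>?L)) / T) \<longlonglongrightarrow> (a - (\<integral>\<tau>. \<Phi> \<tau> \<partial>?L)) / T"
    using T by (intro tendsto_intros) auto
  have "((\<integral>\<tau>. w i \<tau> \<partial>?L) - (\<integral>\<tau>. w i \<tau> - w i 0 \<partial>?L)) / T = w i 0" for i
  proof -
    have "(\<integral>\<tau>. w i \<tau> - w i 0 \<partial>?L) = (\<integral>\<tau>. w i \<tau> \<partial>?L) - (\<integral>\<tau>. w i 0 \<partial>?L)"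
      by (rule Bochner_Integration.integral_diff[OF integrable_on_Icc_bounded[OF wm wb] constL])
    then show ?thesis using T by (simp add: measure_restrict_space)
  qed
  with lim obtain c where c: "(\<lambda>i. w i 0) \<longlonglongrightarrow> c" by auto
  define v where "v = (\<lambda>\<tau>. c + \<Phi> \<tau>)"
  have wv: "(\<lambda>i. w i \<tau>) \<longlonglongrightarrow> v \<tau>" if "\<tau> \<in> {0..T}" for \<tau>
    using tendsto_add[OF c incr[OF that]] by (simp add: v_def)
  \<comment> \<open>The uniform Lipschitz bound passes to the pointwise limit and provides the
    continuity of \<open>v\<close> that the next test function needs.\<close>
  have vlip: "\<bar>v t - v s\<bar> \<le> C * \<bar>t - s\<bar>" if "s \<in> {0..T}" "t \<in> {0..T}" for s t
    by (rule LIMSEQ_le_const2[OF tendsto_rabs[OF tendsto_diff[OF wv wv]]])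
      (use that wlip in auto)
  have vb: "\<bar>v \<tau>\<bar> \<le> Cq" if "\<tau> \<in> {0..T}" for \<tau>
    by (rule LIMSEQ_le_const2[OF tendsto_rabs[OF wv[OF that]]]) (use that wb in auto)
  have vc: "continuous_on {0..T} v"
    by (intro lipschitz_on_continuous_on[of C] lipschitz_onI) (use vlip C0 in \<open>auto simp: dist_real_def\<close>)
  have vm: "v \<in> borel_measurable ?L"
    by (rule continuous_imp_measurable_on_sets_lebesgue[OF vc]) simp
  define f where "f = (\<lambda>p. (q' (snd p) - v (fst p))\<^sup>2)"
  have sq: "(q' V - v \<tau>)\<^sup>2 \<le> (2 * Cq)\<^sup>2" if "\<tau> \<in> {0..T}" for \<tau> V
    using Cq[of V] vb[OF that] by (intro abs_le_square_iff[THEN iffD1]) linarith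
  have "AE \<tau> in ?L. AE V in \<mu> \<tau>. f (\<tau>, V) = 0"
  proof (rule young_limit_zero_AE[OF T X \<mu> conv])
    show "continuous_on ({0..T} \<times> UNIV) f"
      unfolding f_def
      by (auto intro!: continuous_intros continuous_on_compose2[OF q'c[of UNIV]] continuous_on_compose2[OF vc])
    show "0 \<le> f (\<tau>, V) \<and> f (\<tau>, V) \<le> (2 * Cq)\<^sup>2" if "\<tau> \<in> {0..T}" for \<tau> V
      using sq[OF that] by (simp add: f_def)
    have "(\<lambda>i. \<integral>\<tau>. f (\<tau>, X i \<tau>) \<partial>?L) \<longlonglongrightarrow> (\<integral>\<tau>. 0 \<partial>?L)"
    proof (rule integral_dominated_convergence[where w = "\<lambda>_. (2 * Cq)\<^sup>2"])
      have "(\<lambda>\<tau>. (w i \<tau> - v \<tau>)\<^sup>2) \<in> borel_measurable ?L" for i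
        using wm vm by simp
      then show "(\<lambda>\<tau>. f (\<tau>, X i \<tau>)) \<in> borel_measurable ?L" for i
        by (rule measurable_cong[THEN iffD1, rotated]) (auto simp: f_def w_def q'X)
      show "AE \<tau> in ?L. (\<lambda>i. f (\<tau>, X i \<tau>)) \<longlonglongrightarrow> 0"
      proof (rule AE_I2)
        fix \<tau> assume "\<tau> \<in> space ?L"
        then have \<tau>: "\<tau> \<in> {0..T}" by simp
        have "(\<lambda>i. (w i \<tau> - v \<tau>)\<^sup>2) \<longlonglongrightarrow> (v \<tau> - v \<tau>)\<^sup>2" by (intro tendsto_intros wv \<tau>)
        then show "(\<lambda>i. f (\<tau>, X i \<tau>)) \<longlonglongrightarrow> 0" using q'X[OF \<tau>] by (simp add: f_def w_def)
      qed
    qed (use constL sq in \<open>auto simp: f_def intro!: AE_I2\<close>)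
    then show "(\<lambda>i. \<integral>\<tau>. f (\<tau>, X i \<tau>) \<partial>?L) \<longlonglongrightarrow> 0" by simp
  qed
  \<comment> \<open>Concentration on the box turns the statement about the extension
    \<open>q'\<close> into one about \<open>q\<close>.\<close>
  moreover have "AE \<tau> in ?L. AE V in \<mu> \<tau>. V \<in> cbox l u"
    by (rule young_concentrated_AE[OF T X \<mu> conv closed_cbox XB])
  ultimately have supp: "AE \<tau> in ?L. AE V in \<mu> \<tau>. V \<in> cbox l u \<and> q V = v \<tau>"
  proof eventually_elim
    case (elim \<tau>)
    then show ?case by eventually_elim (auto simp: f_def q'_def)
  qed
  have "AE \<tau> in ?L. (v has_real_derivative g \<tau>) (at \<tau> within {0..T})"
  proof -
    have "AE \<tau> in ?L. (\<Phi> has_real_derivative g \<tau>) (at \<tau> within {0..T})"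
      unfolding \<Phi>_def by (rule indefinite_integral_has_derivative_AE[OF gm gC])
    then show ?thesis
      by eventually_elim (auto simp: v_def intro!: derivative_eq_intros)
  qed
  then show thesis
    using that[OF vlip wv[unfolded w_def] supp] by (simp add: g_def F'_def)
qed

section \<open>The Lax equation and the observables\<close>

lemma has_derivative_vec_lambda:
  fixes f :: "'n::finite \<Rightarrow> 'a::real_normed_vector \<Rightarrow> 'b::euclidean_space"
  assumes "\<And>k. (f k has_derivative f' k) F"
  shows "((\<lambda>x. \<chi> k. f k x) has_derivative (\<lambda>h. \<chi> k. f' k h)) F"
proof -
  have eq: "(\<lambda>x. \<chi> k. g k x) = (\<lambda>x. \<Sum>k\<in>UNIV. axis k (g k x))" for g :: "'n \<Rightarrow> 'a \<Rightarrow> 'b"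
    by (simp add: fun_eq_iff vec_eq_iff axis_def)
  have "bounded_linear (axis k :: 'b \<Rightarrow> ('b, 'n) vec)" for k
    unfolding linear_conv_bounded_linear[symmetric] by (auto intro!: linearI simp: vec_eq_iff axis_def)
  then show ?thesis
    unfolding eq by (intro has_derivative_sum bounded_linear.has_derivative[of "axis _"] assms)
qed

lemma bounded_bilinear_matrix_mult:
  "bounded_bilinear ((**) :: real ^ 'n ^ 'n \<Rightarrow> real ^ 'n ^ 'n \<Rightarrow> real ^ 'n ^ 'n::finite)"
  unfolding bilinear_conv_bounded_bilinear[symmetric] bilinear_def
  by (auto intro!: linearI simp: matrix_matrix_mult_def vec_eq_iff sum.distrib sum_distrib_left algebra_simps)

lemma bounded_linear_trace: "bounded_linear (trace :: real ^ 'n ^ 'n::finite \<Rightarrow> real)"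
  by (simp add: linear_conv_bounded_linear[symmetric])
    (auto intro!: linearI simp: trace_def sum.distrib sum_distrib_left)

lemma matrix_power_0 [simp]: "matrix_power L 0 = mat 1"
  by (simp add: matrix_power_def)

lemma matrix_power_Suc [simp]: "matrix_power L (Suc m) = L ** matrix_power L m"
  by (simp add: matrix_power_def)

text \<open>The noncommutative Leibniz sum of all products of \<open>m\<close> factors with one
  factor \<open>L\<close> replaced by \<open>D\<close>, in a recursion that matches the product rule
  for \<open>L ** matrix_power L m\<close>.\<close>

primrec matrix_power_deriv ::
    "real ^ 'n ^ 'n::finite \<Rightarrow> real ^ 'n ^ 'n::finite \<Rightarrow> nat \<Rightarrow> real ^ 'n ^ 'n::finite" where
  "matrix_power_deriv L D 0 = 0"
| "matrix_power_deriv L D (Suc m) = L ** matrix_power_deriv L D m + D ** matrix_power L m"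

lemma has_derivative_matrix_power:
  fixes L :: "'a::real_normed_vector \<Rightarrow> real ^ 'n ^ 'n::finite"
  assumes "(L has_derivative L') (at x)"
  shows "((\<lambda>y. matrix_power (L y) m) has_derivative (\<lambda>h. matrix_power_deriv (L x) (L' h) m)) (at x)"
proof (induction m)
  case (Suc m)
  from bounded_bilinear.FDERIV[OF bounded_bilinear_matrix_mult assms Suc.IH] show ?case by simp
qed simp

text \<open>Commutation with \<open>B\<close> is a derivation, so inserting a commutator makes the
  Leibniz sum telescope to the commutator of the power. Its trace then vanishes.\<close>

lemma matrix_power_deriv_commutator:
  "matrix_power_deriv L (L ** B - B ** L) m = matrix_power L m ** B - B ** matrix_power L m"
  by (induction m) (simp_all add: bounded_bilinear.diff_left[OF bounded_bilinear_matrix_mult]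
    bounded_bilinear.diff_right[OF bounded_bilinear_matrix_mult] matrix_mul_assoc)

section \<open>The Lax pair of the convection\<close>

text \<open>On the positive orthant this is the derivative of \<open>lax_matrix\<close> at
  \<open>U\<close> in direction \<open>W\<close>, the entries being square roots.\<close>

definition lax_tangent ::
    "real ^ 'n::{finite,comm_ring_1} \<Rightarrow> real ^ 'n::{finite,comm_ring_1} \<Rightarrow> real ^ 'n::{finite,comm_ring_1} ^ 'n::{finite,comm_ring_1}" where
  "lax_tangent U W = matrix (\<lambda>x. \<chi> k. W $ k / (2 * sqrt (U $ k)) * x $ (k + 1)
    + W $ (k - 1) / (2 * sqrt (U $ (k - 1))) * x $ (k - 1))"

text \<open>The skew-symmetric partner in the Lax pair of the Volterra (Kac-van Moerbeke) lattice.
  It couples indices at distance two; describing it by its action avoids separate cases for small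
  \<open>N\<close>, where shifted indices coincide.\<close>

definition lax_companion :: "real ^ 'n::{finite,comm_ring_1} \<Rightarrow> real ^ 'n::{finite,comm_ring_1} ^ 'n::{finite,comm_ring_1}" where
  "lax_companion U = matrix (\<lambda>x. \<chi> k. (sqrt (U $ (k - 1)) * sqrt (U $ (k - 1 - 1)) * x $ (k - 1 - 1)
    - sqrt (U $ k) * sqrt (U $ (k + 1)) * x $ (k + 1 + 1)) / 2)"

lemma matrix_works_real:
  fixes f :: "real ^ 'n \<Rightarrow> real ^ 'm::finite"
  assumes "linear f" shows "matrix f *v x = f x"
  using assms by (intro matrix_works) (simp add: linear_matrix_vector_mul_eq)

lemma lax_matrix_mult:
  "(lax_matrix U *v x) $ k = sqrt (U $ k) * x $ (k + 1) + sqrt (U $ (k - 1)) * x $ (k - 1)"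
  unfolding lax_matrix_def
  by (subst matrix_works_real) (auto intro!: linearI simp: vec_eq_iff algebra_simps add_divide_distrib)

lemma lax_tangent_mult:
  "(lax_tangent U W *v x) $ k = W $ k / (2 * sqrt (U $ k)) * x $ (k + 1)
    + W $ (k - 1) / (2 * sqrt (U $ (k - 1))) * x $ (k - 1)"
  unfolding lax_tangent_def
  by (subst matrix_works_real) (auto intro!: linearI simp: vec_eq_iff algebra_simps add_divide_distrib)

lemma lax_companion_mult:
  "(lax_companion U *v x) $ k = (sqrt (U $ (k - 1)) * sqrt (U $ (k - 1 - 1)) * x $ (k - 1 - 1)
    - sqrt (U $ k) * sqrt (U $ (k + 1)) * x $ (k + 1 + 1)) / 2"
  unfolding lax_companion_def
  by (subst matrix_works_real) (auto intro!: linearI simp: vec_eq_iff algebra_simps diff_divide_distrib add_divide_distrib)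

text \<open>Compare the action on a vector row by row. In the commutator the terms in
  \<open>x\<close> at distance three cancel, and those at distance one combine to the derivative of
  the square roots along the convection.\<close>

lemma lax_equation:
  assumes "U \<in> positive_orthant"
  shows "lax_tangent U (convection U) = lax_matrix U ** lax_companion U - lax_companion U ** lax_matrix U"
proof -
  define a where "a = (\<lambda>k. sqrt (U $ k))"
  have U: "U $ k = a k * a k" and a: "a k \<noteq> 0" for k
    using assms less_imp_le[of 0 "U $ k"] by (auto simp: a_def positive_orthant_def)
       (metis less_irrefl)
  \<comment> \<open>Named shifts make the indices atoms, so the row becomes a field identity in the
    values of \<open>a\<close> and \<open>x\<close>, with cancellation of opposite shifts as the
    only index rule.\<close>
  define s p where "s = (\<lambda>k :: 'a. k + 1)" and "p = (\<lambda>k :: 'a. k - 1)"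
  have sp: "s (p k) = k" "p (s k) = k" for k by (auto simp: s_def p_def)
  have fold: "sqrt (U $ k) = a k" "k + 1 = s k" "k - 1 = p k" for k
    by (simp_all add: a_def s_def p_def)
  have "(lax_tangent U (convection U) *v x) $ k =
    ((lax_matrix U ** lax_companion U - lax_companion U ** lax_matrix U) *v x) $ k" for x k
    unfolding matrix_vector_mult_diff_rdistrib matrix_vector_mul_assoc[symmetric] vector_minus_component
      lax_tangent_mult lax_matrix_mult lax_companion_mult convection_def vec_lambda_beta
    unfolding fold unfolding U sp
    using a by (simp add: field_simps)
  then show ?thesis by (auto simp: matrix_eq vec_eq_iff)
qed

section \<open>Gradients of the observables and their invariance under the convection\<close>

definition observable_deriv ::
    "nat \<Rightarrow> real ^ 'n::{finite,comm_ring_1} \<Rightarrow> real ^ 'n::{finite,comm_ring_1} \<Rightarrow> real" where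
  "observable_deriv j U W =
    (if j \<le> CARD('n) div 2 then trace (matrix_power_deriv (lax_matrix U) (lax_tangent U W) (2 * j))
     else \<Sum>k\<in>UNIV. W $ k * (\<Prod>i\<in>UNIV - {k}. U $ i))"

lemma open_positive_orthant: "open (positive_orthant :: (real ^ 'n::finite) set)"
proof -
  have "open (\<Inter>k. {U :: real ^ 'n. U $ k > 0})"
    by (intro open_INT finite ballI open_Collect_less continuous_intros)
  also have "(\<Inter>k. {U :: real ^ 'n. U $ k > 0}) = positive_orthant"
    by (auto simp: positive_orthant_def)
  finally show ?thesis .
qed

text \<open>The entry is a sum of two conditionals, not a case distinction, because both neighbours
  are the same index when \<open>N = 2\<close>.\<close>

lemma lax_matrix_entries:
  "lax_matrix U = (\<chi> i j. (if j = i + 1 then sqrt (U $ i) else 0) + (if j = i - 1 then sqrt (U $ (i - 1)) else 0))"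
proof -
  have "(\<chi> i j. (if j = i + 1 then sqrt (U $ i) else 0) + (if j = i - 1 then sqrt (U $ (i - 1)) else 0)) *v x
      = lax_matrix U *v x" for x
    unfolding vec_eq_iff lax_matrix_mult
    by (simp add: matrix_vector_mult_def distrib_right sum.distrib if_distrib[of "\<lambda>a. a * _"] cong: if_cong)
  then show ?thesis by (simp add: matrix_eq)
qed

lemma lax_tangent_entries:
  "lax_tangent U W = (\<chi> i j. (if j = i + 1 then W $ i / (2 * sqrt (U $ i)) else 0)
    + (if j = i - 1 then W $ (i - 1) / (2 * sqrt (U $ (i - 1))) else 0))"
proof -
  have "(\<chi> i j. (if j = i + 1 then W $ i / (2 * sqrt (U $ i)) else 0)
      + (if j = i - 1 then W $ (i - 1) / (2 * sqrt (U $ (i - 1))) else 0)) *v x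
      = lax_tangent U W *v x" for x
    unfolding vec_eq_iff lax_tangent_mult
    by (simp add: matrix_vector_mult_def distrib_right sum.distrib if_distrib[of "\<lambda>a. a * _"] cong: if_cong)
  then show ?thesis by (simp add: matrix_eq)
qed

lemma has_derivative_matrix_entries:
  fixes f :: "'a::real_normed_vector \<Rightarrow> real ^ 'm::finite ^ 'n::finite"
  assumes "\<And>i j. ((\<lambda>x. f x $ i $ j) has_derivative (\<lambda>h. f' h $ i $ j)) F"
  shows "(f has_derivative f') F"
proof -
  have "((\<lambda>x. \<chi> i. \<chi> j. f x $ i $ j) has_derivative (\<lambda>h. \<chi> i. \<chi> j. f' h $ i $ j)) F"
    by (intro has_derivative_vec_lambda assms)
  then show ?thesis by simp
qed

lemma has_derivative_lax_matrix:
  assumes "U \<in> positive_orthant"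
  shows "(lax_matrix has_derivative lax_tangent U) (at U)"
proof (rule has_derivative_matrix_entries)
  fix i j
  have d: "((\<lambda>V. sqrt (V $ k)) has_derivative (\<lambda>W. W $ k / (2 * sqrt (U $ k)))) (at U)" for k
    using assms by (auto intro!: derivative_eq_intros bounded_linear_imp_has_derivative[OF bounded_linear_vec_nth]
      simp: positive_orthant_def field_simps)
  show "((\<lambda>V. lax_matrix V $ i $ j) has_derivative (\<lambda>W. lax_tangent U W $ i $ j)) (at U)"
    unfolding lax_matrix_entries lax_tangent_entries vec_lambda_beta
    by (intro has_derivative_add; cases "j = i + 1"; cases "j = i - 1") (simp_all add: d)
qed

lemma has_derivative_observable:
  fixes U :: "real ^ 'n::{finite,comm_ring_1}"
  assumes "U \<in> positive_orthant"
  shows "(observable j has_derivative observable_deriv j U) (at U)"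
proof (cases "j \<le> CARD('n) div 2")
  case True
  then show ?thesis
    unfolding observable_def[abs_def] observable_deriv_def[abs_def]
    using bounded_linear.has_derivative[OF bounded_linear_trace
      has_derivative_matrix_power[OF has_derivative_lax_matrix[OF assms]]]
    by simp
next
  case False
  have "((\<lambda>V :: (real, 'n) vec. \<Prod>k\<in>UNIV. V $ k) has_derivative (\<lambda>W. \<Sum>k\<in>UNIV. W $ k * (\<Prod>i\<in>UNIV - {k}. U $ i))) (at U)"
    by (intro has_derivative_prod bounded_linear_imp_has_derivative bounded_linear_vec_nth)
  with False show ?thesis
    unfolding observable_def[abs_def] observable_deriv_def[abs_def] by simp
qed

lemma linear_observable_deriv:
  assumes "U \<in> positive_orthant"
  shows "linear (observable_deriv j U)"
  using has_derivative_observable[OF assms] has_derivative_linear by blast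

text \<open>Shows that the definite description in \<open>grad\<close> denotes: the derivative is a
  linear functional, represented by its adjoint applied to 1, and uniqueness of derivatives gives
  uniqueness of the representing vector.\<close>

lemma grad_observable:
  assumes "U \<in> positive_orthant"
  shows "grad (observable j) U \<bullet> W = observable_deriv j U W"
proof -
  define f' where "f' = observable_deriv j U"
  have lin: "linear f'" and der: "(observable j has_derivative f') (at U)"
    unfolding f'_def by (rule linear_observable_deriv[OF assms] has_derivative_observable[OF assms])+
  have inner: "f' h = h \<bullet> adjoint f' 1" for h
    using adjoint_works[OF lin, of h 1] by (simp add: inner_commute)
  have G: "GDERIV (observable j) U :> adjoint f' 1"
    using der inner unfolding gderiv_def
    by (metis (no_types, lifting) ext)
  have "grad (observable j) U = adjoint f' 1"
    unfolding grad_def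
  proof (rule the_equality)
    show "GDERIV (observable j) U :> adjoint f' 1" by (rule G)
    fix D assume "GDERIV (observable j) U :> D"
    then have "(\<lambda>h. h \<bullet> D) = f'"
      unfolding gderiv_def using has_derivative_unique[OF _ der] by blast
    then have "\<forall>h. h \<bullet> D = h \<bullet> adjoint f' 1" using inner by (simp add: fun_eq_iff)
    then show "D = adjoint f' 1" by (simp add: vector_eq_ldot)
  qed
  with inner[of W] show ?thesis by (simp add: inner_commute f'_def)
qed

lemma sum_shift:
  fixes f :: "'n::{finite,comm_ring_1} \<Rightarrow> real"
  shows "(\<Sum>k\<in>UNIV. f (k + 1)) = (\<Sum>k\<in>UNIV. f k)" "(\<Sum>k\<in>UNIV. f (k - 1)) = (\<Sum>k\<in>UNIV. f k)"
  by (rule sum.reindex_bij_witness[of _ "\<lambda>k. k - 1" "\<lambda>k. k + 1"], simp_all)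
    (rule sum.reindex_bij_witness[of _ "\<lambda>k. k + 1" "\<lambda>k. k - 1"], simp_all)

text \<open>The factor \<open>U $ k\<close> of the convection completes the punctured product to the
  full one, which factors out; the remaining differences cancel cyclically.\<close>

lemma prod_convection:
  fixes U :: "real ^ 'n::{finite,comm_ring_1}"
  shows "(\<Sum>k\<in>UNIV. convection U $ k * (\<Prod>i\<in>UNIV - {k}. U $ i)) = 0"
proof -
  have "(\<Sum>k\<in>UNIV. convection U $ k * (\<Prod>i\<in>UNIV - {k}. U $ i))
      = (\<Sum>k\<in>UNIV. (U $ (k + 1) - U $ (k - 1)) * (\<Prod>i\<in>UNIV. U $ i))"
  proof (intro sum.cong refl)
    fix k
    show "convection U $ k * (\<Prod>i\<in>UNIV - {k}. U $ i) = (U $ (k + 1) - U $ (k - 1)) * (\<Prod>i\<in>UNIV. U $ i)"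
      by (simp add: convection_def prod.remove[of UNIV k])
  qed
  also have "\<dots> = 0"
    using sum_shift[of "\<lambda>k. U $ k"] by (simp add: sum_distrib_right[symmetric] sum_subtractf)
  finally show ?thesis .
qed

text \<open>Traces of powers are invariant because the trace of a commutator is zero; the product is
  covered by \<open>prod_convection\<close>.\<close>

lemma observable_deriv_convection:
  assumes "U \<in> positive_orthant"
  shows "observable_deriv j U (convection U) = 0"
  by (simp add: observable_deriv_def lax_equation[OF assms] matrix_power_deriv_commutator
      trace_sub trace_mul_sym[of "lax_companion U"] prod_convection)

lemma continuous_on_matrix_mult:
  fixes f g :: "'a::topological_space \<Rightarrow> real ^ 'n ^ 'n::finite"
  shows "continuous_on S f \<Longrightarrow> continuous_on S g \<Longrightarrow> continuous_on S (\<lambda>x. f x ** g x)"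
  by (rule bounded_bilinear.continuous_on[OF bounded_bilinear_matrix_mult])

lemma continuous_on_matrix_power_deriv:
  fixes L D :: "'a::topological_space \<Rightarrow> real ^ 'n ^ 'n::finite"
  assumes L: "continuous_on S L" and D: "continuous_on S D"
  shows "continuous_on S (\<lambda>x. matrix_power_deriv (L x) (D x) m)"
proof (induction m)
  case (Suc m)
  have "continuous_on S (\<lambda>x. matrix_power (L x) m)"
  proof (induction m)
    case (Suc m)
    show ?case unfolding matrix_power_Suc by (rule continuous_on_matrix_mult[OF L Suc.IH])
  qed simp
  then show ?case
    unfolding matrix_power_deriv.simps
    by (rule continuous_on_add[OF continuous_on_matrix_mult[OF L Suc.IH] continuous_on_matrix_mult[OF D]])
qed simp

lemma continuous_on_observable_deriv_diffusion:
  fixes h :: real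
  shows "continuous_on positive_orthant (\<lambda>U :: real ^ 'n::{finite,comm_ring_1}. observable_deriv j U (diffusion h U))"
proof -
  have g: "continuous_on positive_orthant (\<lambda>U :: (real, 'n) vec. diffusion h U $ k)" for k
    unfolding diffusion_def vec_lambda_beta by (intro continuous_intros)
  have L: "continuous_on positive_orthant (lax_matrix :: (real, 'n) vec \<Rightarrow> _)"
    using has_derivative_lax_matrix has_derivative_continuous continuous_at_imp_continuous_on by blast
  have e: "continuous_on positive_orthant (\<lambda>U :: (real, 'n) vec. if P then diffusion h U $ k / (2 * sqrt (U $ k)) else 0)" for P k
  proof (cases P)
    case True
    have "continuous_on positive_orthant (\<lambda>U :: (real, 'n) vec. diffusion h U $ k / (2 * sqrt (U $ k)))"
      by (intro continuous_on_divide g continuous_intros) (auto simp: positive_orthant_def less_imp_neq[symmetric])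
    with True show ?thesis by simp
  qed simp
  have "continuous_on positive_orthant (\<lambda>U :: (real, 'n) vec. lax_tangent U (diffusion h U))"
    unfolding lax_tangent_entries by (intro continuous_intros e)
  with L have "continuous_on positive_orthant
      (\<lambda>U :: (real, 'n) vec. trace (matrix_power_deriv (lax_matrix U) (lax_tangent U (diffusion h U)) (2 * j)))"
    by (intro bounded_linear.continuous_on[OF bounded_linear_trace] continuous_on_matrix_power_deriv)
  moreover have "continuous_on positive_orthant
      (\<lambda>U :: (real, 'n) vec. \<Sum>k\<in>UNIV. diffusion h U $ k * (\<Prod>i\<in>UNIV - {k}. U $ i))"
    by (intro continuous_intros g)
  ultimately show ?thesis unfolding observable_deriv_def by (cases "j \<le> CARD('n) div 2") auto
qed

section \<open>A priori bounds\<close>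

lemma sum_diffusion:
  fixes U :: "real ^ 'n::{finite,comm_ring_1}"
  shows "(\<Sum>k\<in>UNIV. diffusion h U $ k) = 0"
  unfolding diffusion_def vec_lambda_beta sum_distrib_left[symmetric]
  using sum_shift[of "\<lambda>k. U $ k"]
  by (simp add: sum.distrib sum_subtractf sum_distrib_left[symmetric])

lemma sum_convection:
  fixes U :: "real ^ 'n::{finite,comm_ring_1}"
  shows "(\<Sum>k\<in>UNIV. convection U $ k) = 0"
  using sum_shift(1)[of "\<lambda>k. U $ k * U $ (k - 1)"]
  by (simp add: convection_def right_diff_distrib sum_subtractf mult.commute)

text \<open>Pairing each edge ratio with its inverse, the sum below is
  \<open>\<Prod>U / h\<^sup>2 * \<Sum>\<^sub>k (U\<^sub>k\<^sub>+\<^sub>1 / U\<^sub>k + U\<^sub>k / U\<^sub>k\<^sub>+\<^sub>1 - 2)\<close>.\<close>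

lemma prod_diffusion_nonneg:
  fixes U :: "real ^ 'n::{finite,comm_ring_1}"
  assumes "U \<in> positive_orthant"
  shows "0 \<le> (\<Sum>k\<in>UNIV. diffusion h U $ k * (\<Prod>i\<in>UNIV - {k}. U $ i))"
proof -
  have U: "0 < U $ k" for k using assms by (simp add: positive_orthant_def)
  define P where "P = (\<Prod>i\<in>UNIV. U $ i)"
  have P: "0 \<le> P" unfolding P_def using U by (intro prod_nonneg) (auto intro: less_imp_le)
  have Pk: "(\<Prod>i\<in>UNIV - {k}. U $ i) = P / U $ k" for k
    using U[of k] by (simp add: P_def prod.remove[of UNIV k])
  have amgm: "2 \<le> x / y + y / x" if "0 < x" "0 < y" for x y :: real
  proof -
    have "2 * (x * y) \<le> x * x + y * y" using sum_squares_bound[of x y] by (simp add: power2_eq_square)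
    then show ?thesis using that by (simp add: field_simps)
  qed
  have "(\<Sum>k\<in>UNIV. diffusion h U $ k * (\<Prod>i\<in>UNIV - {k}. U $ i))
      = (\<Sum>k\<in>UNIV. P / h\<^sup>2 * (U $ (k + 1) / U $ k + U $ (k - 1) / U $ k - 2))"
  proof (intro sum.cong refl)
    fix k
    show "diffusion h U $ k * (\<Prod>i\<in>UNIV - {k}. U $ i) = P / h\<^sup>2 * (U $ (k + 1) / U $ k + U $ (k - 1) / U $ k - 2)"
      unfolding Pk diffusion_def using U[of k] by (simp add: field_simps)
  qed
  also have "\<dots> = P / h\<^sup>2 * (\<Sum>k\<in>UNIV. U $ (k + 1) / U $ k + U $ k / U $ (k + 1) - 2)"
    unfolding sum_distrib_left[symmetric]
    using sum_shift(1)[of "\<lambda>k. U $ (k - 1) / U $ k"]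
    by (simp add: sum.distrib sum_subtractf)
  also have "\<dots> \<ge> 0"
    using P U amgm by (intro mult_nonneg_nonneg divide_nonneg_nonneg sum_nonneg) auto
  finally show ?thesis .
qed

section \<open>Solutions remain in a compact box of the orthant\<close>

lemma full_solution_component:
  assumes "full_solution h e T X" "\<tau> \<in> {0..T}"
  shows "((\<lambda>t. X t $ k) has_real_derivative
    (diffusion h (X \<tau>) $ k - 1 / (2 * h * e) * convection (X \<tau>) $ k)) (at \<tau> within {0..T})"
proof -
  have "(X has_vector_derivative (diffusion h (X \<tau>) - (1 / (2 * h * e)) *\<^sub>R convection (X \<tau>))) (at \<tau> within {0..T})"
    using assms by (simp add: full_solution_def)
  from bounded_linear.has_vector_derivative[OF bounded_linear_vec_nth this, of k]
  show ?thesis by (simp add: has_real_derivative_iff_has_vector_derivative)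
qed

lemma full_solution_continuous:
  assumes "full_solution h e T X"
  shows "continuous_on {0..T} X"
  using assms unfolding full_solution_def continuous_on_eq_continuous_within
  by (blast intro: has_vector_derivative_continuous)

lemma full_solution_sum:
  assumes "full_solution h e T X" "\<tau> \<in> {0..T}"
  shows "(\<Sum>k\<in>UNIV. X \<tau> $ k) = (\<Sum>k\<in>UNIV. X 0 $ k)"
proof -
  have "((\<lambda>t. \<Sum>k\<in>UNIV. X t $ k) has_real_derivative 0) (at t within {0..T})" if "t \<in> {0..T}" for t
  proof -
    have "((\<lambda>t. \<Sum>k\<in>UNIV. X t $ k) has_real_derivative
        (\<Sum>k\<in>UNIV. diffusion h (X t) $ k - 1 / (2 * h * e) * convection (X t) $ k)) (at t within {0..T})"
      by (intro DERIV_sum full_solution_component[OF assms(1) that])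
    then show ?thesis
      by (simp add: sum_subtractf sum_diffusion sum_convection sum_divide_distrib[symmetric])
  qed
  then obtain c where "\<forall>t\<in>{0..T}. (\<Sum>k\<in>UNIV. X t $ k) = c"
    using has_field_derivative_zero_constant[of "{0..T}" "\<lambda>t. \<Sum>k\<in>UNIV. X t $ k"] by auto
  then show ?thesis using assms(2) by auto
qed

text \<open>The convection drops out of the derivative of the product and the diffusion contributes
  a nonnegative amount. Positivity is demanded only strictly before \<open>t\<close>, so the lemma
  can be used up to a first exit time.\<close>

lemma full_solution_prod_mono:
  assumes sol: "full_solution h e T X" and t: "t \<in> {0..T}"
    and pos: "\<And>s. 0 < s \<Longrightarrow> s < t \<Longrightarrow> X s \<in> positive_orthant"
  shows "(\<Prod>k\<in>UNIV. X 0 $ k) \<le> (\<Prod>k\<in>UNIV. X t $ k)"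
proof (rule DERIV_nonneg_imp_increasing_open[where f = "\<lambda>t. \<Prod>k\<in>UNIV. X t $ k"])
  show "0 \<le> t" using t by simp
  have "continuous_on {0..t} X"
    using full_solution_continuous[OF sol] by (rule continuous_on_subset) (use t in auto)
  then show "continuous_on {0..t} (\<lambda>t. \<Prod>k\<in>UNIV. X t $ k)"
    by (intro continuous_intros)
  fix s assume s: "0 < s" "s < t"
  then have s': "s \<in> {0..T}" "s \<in> interior {0..T}" using t by auto
  let ?D = "\<lambda>k. diffusion h (X s) $ k - 1 / (2 * h * e) * convection (X s) $ k"
  have "((\<lambda>t. \<Prod>k\<in>UNIV. X t $ k) has_real_derivative
      (\<Sum>k\<in>UNIV. ?D k * (\<Prod>i\<in>UNIV - {k}. X s $ i))) (at s)"
  proof -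
    have "((\<lambda>t. X t $ k) has_derivative (\<lambda>y. y * ?D k)) (at s)" for k
      using full_solution_component[OF sol s'(1), of k] at_within_interior[OF s'(2)]
      by (simp add: has_field_derivative_def mult.commute[of "_ - _"] mult_commute_abs)
    then have "((\<lambda>t. \<Prod>k\<in>UNIV. X t $ k) has_derivative
        (\<lambda>y. \<Sum>k\<in>UNIV. (y * ?D k) * (\<Prod>i\<in>UNIV - {k}. X s $ i))) (at s)"
      by (intro has_derivative_prod)
    then show ?thesis
      by (simp add: has_field_derivative_def sum_distrib_left[symmetric] mult.assoc mult_commute_abs)
  qed
  moreover have "(\<Sum>k\<in>UNIV. ?D k * (\<Prod>i\<in>UNIV - {k}. X s $ i))
      = (\<Sum>k\<in>UNIV. diffusion h (X s) $ k * (\<Prod>i\<in>UNIV - {k}. X s $ i))"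
    using prod_convection[of "X s"]
    by (simp add: left_diff_distrib sum_subtractf mult.assoc sum_divide_distrib[symmetric])
  ultimately show "\<exists>y. ((\<lambda>t. \<Prod>k\<in>UNIV. X t $ k) has_real_derivative y) (at s) \<and> 0 \<le> y"
    using prod_diffusion_nonneg[OF pos[OF s]] by auto
qed

text \<open>At a first exit time the coordinates are nonnegative by continuity, yet their product is
  at least the positive initial one; none can vanish, so there is no exit.\<close>

lemma full_solution_positive:
  assumes sol: "full_solution h e T X" and X0: "X 0 \<in> positive_orthant" and \<tau>: "\<tau> \<in> {0..T}"
  shows "X \<tau> \<in> positive_orthant"
proof (rule ccontr)
  assume neg: "X \<tau> \<notin> positive_orthant"
  note Xc = full_solution_continuous[OF sol]
  define Z where "Z = {t \<in> {0..T}. X t \<in> - positive_orthant}"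
  \<comment> \<open>Closedness ensures that the infimum is attained, that is, that a first exit time
    exists.\<close>
  have "closed Z"
    unfolding Z_def vimage_def[symmetric] Int_def[symmetric]
    using continuous_closed_preimage[OF Xc closed_real_atLeastAtMost, of "- positive_orthant"] open_positive_orthant
    by (simp add: vimage_def Int_def closed_def)
  moreover have "\<tau> \<in> Z" "bdd_below Z" using neg \<tau> by (auto simp: Z_def bdd_below_def)
  ultimately have t0: "Inf Z \<in> Z" by (intro closed_contains_Inf) auto
  define t where "t = Inf Z"
  have t: "t \<in> {0..T}" "X t \<notin> positive_orthant" using t0 by (auto simp: Z_def t_def)
  have pos: "X s \<in> positive_orthant" if "0 \<le> s" "s < t" for s
  proof (rule ccontr)
    assume "X s \<notin> positive_orthant"
    then have "s \<in> Z" using that t by (simp add: Z_def)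
    then have "t \<le> s" unfolding t_def using \<open>bdd_below Z\<close> by (rule cInf_lower)
    with that show False by simp
  qed
  have "0 < t" using X0 t by (cases "t = 0") auto
  have nonneg: "0 \<le> X t $ k" for k
  proof (rule continuous_ge_on_closure[of "{0..<t}" "\<lambda>s. X s $ k"])
    have cl: "closure {0..<t} = {0..t}" using \<open>0 < t\<close> by simp
    show "continuous_on (closure {0..<t}) (\<lambda>s. X s $ k)"
      unfolding cl by (intro continuous_intros continuous_on_subset[OF Xc]) (use t in auto)
    show "t \<in> closure {0..<t}" unfolding cl using \<open>0 < t\<close> by simp
    show "0 \<le> X s $ k" if "s \<in> {0..<t}" for s
      using pos[of s] that by (auto simp: positive_orthant_def less_imp_le)
  qed
  have "0 < (\<Prod>k\<in>UNIV. X 0 $ k)"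
    using X0 by (intro prod_pos) (auto simp: positive_orthant_def)
  also have "\<dots> \<le> (\<Prod>k\<in>UNIV. X t $ k)"
    by (rule full_solution_prod_mono[OF sol t(1)]) (auto intro: pos)
  finally have "X t $ k \<noteq> 0" for k
    using prod_zero[of UNIV "\<lambda>k. X t $ k"] by (metis UNIV_I finite less_irrefl)
  with nonneg t(2) show False by (auto simp: positive_orthant_def less_le)
qed

text \<open>The largest coordinate sum and the smallest coordinate product over \<open>K\<close>
  control every solution. Neither refers to \<open>h\<close>, \<open>e\<close> or \<open>T\<close>,
  so one box serves all parameters.\<close>

lemma full_solution_box:
  fixes K :: "(real ^ 'n::{finite,comm_ring_1}) set"
  assumes K: "compact K" "K \<subseteq> positive_orthant"
  obtains l u where "cbox l u \<subseteq> positive_orthant"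
    "\<And>h e T X \<tau>. full_solution h e T X \<Longrightarrow> X 0 \<in> K \<Longrightarrow> \<tau> \<in> {0..T} \<Longrightarrow> X \<tau> \<in> cbox l u"
proof (cases "K = {}")
  case True
  \<comment> \<open>With no initial data the second requirement is vacuous, and any box in the
    orthant will do.\<close>
  then show thesis
    by (intro that[of "\<chi> k. 1" "\<chi> k. 1"])
      (auto simp: mem_box_cart positive_orthant_def intro: less_le_trans[OF zero_less_one])
next
  case False
  have prod: "continuous_on K (\<lambda>V. \<Prod>k\<in>UNIV. V $ k)" and sum: "continuous_on K (\<lambda>V. \<Sum>k\<in>UNIV. V $ k)"
    by (intro continuous_intros)+
  obtain A where A: "A \<in> K" "\<And>V. V \<in> K \<Longrightarrow> (\<Prod>k\<in>UNIV. A $ k) \<le> (\<Prod>k\<in>UNIV. V $ k)"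
    using continuous_attains_inf[OF K(1) False prod] by blast
  obtain B where B: "B \<in> K" "\<And>V. V \<in> K \<Longrightarrow> (\<Sum>k\<in>UNIV. V $ k) \<le> (\<Sum>k\<in>UNIV. B $ k)"
    using continuous_attains_sup[OF K(1) False sum] by blast
  define p C where "p = (\<Prod>k\<in>UNIV. A $ k)" and "C = (\<Sum>k\<in>UNIV. B $ k)"
  have "0 < p" using A(1) K(2) unfolding p_def by (intro prod_pos) (auto simp: positive_orthant_def)
  have "0 < C" using B(1) K(2) unfolding C_def by (intro sum_pos) (auto simp: positive_orthant_def)
  \<comment> \<open>If the product is at least \<open>p\<close> and the other coordinates are at
    most \<open>C\<close>, the remaining one is at least this quotient.\<close>
  define m where "m = p / C ^ (CARD('n) - 1)"
  have "0 < m" using \<open>0 < p\<close> \<open>0 < C\<close> by (simp add: m_def)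
  show thesis
  proof (rule that[of "\<chi> k. m" "\<chi> k. C"])
    show "cbox (\<chi> k. m) (\<chi> k. C) \<subseteq> (positive_orthant :: ((real, 'n) vec) set)"
      using \<open>0 < m\<close> by (auto simp: mem_box_cart positive_orthant_def intro: less_le_trans)
    fix h e T \<tau> :: real and X :: "real \<Rightarrow> (real, 'n) vec"
    assume sol: "full_solution h e T X" and X0: "X 0 \<in> K" and \<tau>: "\<tau> \<in> {0..T}"
    have pos: "X s \<in> positive_orthant" if "s \<in> {0..T}" for s
      using full_solution_positive[OF sol _ that] X0 K(2) by auto
    have X: "0 < X \<tau> $ k" for k using pos[OF \<tau>] by (simp add: positive_orthant_def)
    have upper: "X \<tau> $ k \<le> C" for k
    proof -
      have "X \<tau> $ k \<le> (\<Sum>k\<in>UNIV. X \<tau> $ k)"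
        by (intro member_le_sum) (auto intro: less_imp_le[OF X])
      also have "\<dots> \<le> C" using full_solution_sum[OF sol \<tau>] B(2)[OF X0] by (simp add: C_def)
      finally show ?thesis .
    qed
    have lower: "m \<le> X \<tau> $ k" for k
    proof -
      have "p \<le> (\<Prod>k\<in>UNIV. X 0 $ k)" using A(2)[OF X0] by (simp add: p_def)
      also have "\<dots> \<le> (\<Prod>k\<in>UNIV. X \<tau> $ k)"
        by (rule full_solution_prod_mono[OF sol \<tau>]) (use \<tau> in \<open>auto intro: pos\<close>)
      also have "\<dots> = X \<tau> $ k * (\<Prod>i\<in>UNIV - {k}. X \<tau> $ i)"
        by (simp add: prod.remove[of UNIV k])
      also have "\<dots> \<le> X \<tau> $ k * (\<Prod>i\<in>UNIV - {k}. C)"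
        using X upper by (intro mult_left_mono prod_mono) (auto intro: less_imp_le)
      also have "(\<Prod>i\<in>UNIV - {k}. C) = C ^ (CARD('n) - 1)"
        by (simp add: card_Diff_singleton)
      finally show ?thesis using \<open>0 < C\<close> by (simp add: m_def field_simps)
    qed
    show "X \<tau> \<in> cbox (\<chi> k. m) (\<chi> k. C)" using lower upper by (simp add: mem_box_cart)
  qed
qed

text \<open>By linearity of the derivative, the singular factor multiplies only the derivative along
  the convection, which is zero.\<close>

lemma full_solution_observable_deriv:
  assumes sol: "full_solution h e T X" and pos: "X \<tau> \<in> positive_orthant" and \<tau>: "\<tau> \<in> {0..T}"
  shows "((\<lambda>t. observable j (X t)) has_real_derivative observable_deriv j (X \<tau>) (diffusion h (X \<tau>)))
    (at \<tau> within {0..T})"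
proof -
  let ?D = "diffusion h (X \<tau>) - (1 / (2 * h * e)) *\<^sub>R convection (X \<tau>)"
  have "(X has_vector_derivative ?D) (at \<tau> within {0..T})"
    using sol \<tau> by (simp add: full_solution_def)
  from vector_derivative_diff_chain_within[OF this
      has_derivative_at_withinI[OF has_derivative_observable[OF pos, of j]]]
  have "((\<lambda>t. observable j (X t)) has_vector_derivative observable_deriv j (X \<tau>) ?D) (at \<tau> within {0..T})"
    by (simp add: o_def)
  moreover have "observable_deriv j (X \<tau>) ?D = observable_deriv j (X \<tau>) (diffusion h (X \<tau>))"
    using linear_observable_deriv[OF pos, of j]
    by (simp add: linear_diff linear_scale observable_deriv_convection[OF pos])
  ultimately show ?thesis by (simp add: has_real_derivative_iff_has_vector_derivative)
qed

section \<open>Supports, measurements and the averaged equation\<close>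

lemma measure_support_subset:
  assumes S: "closed S" and \<mu>: "sets \<mu> = sets borel" and AE: "AE V in \<mu>. V \<in> S"
  shows "measure_support \<mu> \<subseteq> S"
proof
  fix V assume V: "V \<in> measure_support \<mu>"
  show "V \<in> S"
  proof (rule ccontr)
    assume "V \<notin> S"
    have "- S \<in> sets \<mu>" using S \<mu> by auto
    then have "emeasure \<mu> (- S) = 0"
      using AE by (subst (asm) AE_iff_measurable[where N = "- S"]) (use \<mu> in \<open>auto dest: sets_eq_imp_space_eq\<close>)
    moreover have "emeasure \<mu> (- S) > 0"
      using V S \<open>V \<notin> S\<close> unfolding measure_support_def by (auto simp: open_Compl)
    ultimately show False by simp
  qed
qed

text \<open>Otherwise every point has a null open neighbourhood; finitely many of them cover the
  compact set that carries the full mass.\<close>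

lemma measure_support_nonempty:
  assumes S: "compact S" "S \<noteq> {}" and \<mu>: "prob_space \<mu>" "sets \<mu> = sets borel" and AE: "AE V in \<mu>. V \<in> S"
  shows "measure_support \<mu> \<noteq> {}"
proof
  assume "measure_support \<mu> = {}"
  then have "\<forall>V. \<exists>W. open W \<and> V \<in> W \<and> emeasure \<mu> W = 0"
    unfolding measure_support_def by (auto simp: not_gr_zero)
  then obtain W where W: "\<And>V. open (W V)" "\<And>V. V \<in> W V" "\<And>V. emeasure \<mu> (W V) = 0" by metis
  obtain D where D: "finite D" "S \<subseteq> (\<Union>V\<in>D. W V)"
    using compactE_image[OF S(1), of UNIV W] W by (metis UNIV_I UN_I subsetI)
  have "AE V in \<mu>. \<forall>X\<in>D. V \<notin> W X"
    using D(1) W \<mu>(2) by (intro AE_finite_allI AE_not_in) (auto intro!: null_setsI)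
  with AE have "AE V in \<mu>. False"
    by eventually_elim (use D(2) in auto)
  then show False using prob_space.AE_False[OF \<mu>(1)] by simp
qed

text \<open>Nonemptiness of the support makes the described constant unique.\<close>

lemma measurement_eq:
  assumes "measure_support \<mu> \<noteq> {}" "\<And>V. V \<in> measure_support \<mu> \<Longrightarrow> observable j V = c"
  shows "measurement j \<mu> = c"
  unfolding measurement_def using assms by (intro the_equality) auto

section \<open>Absolute continuity, weak convergence and integrals over the orthant\<close>

lemma lipschitz_imp_absolutely_continuous_on:
  assumes w: "\<And>s t. s \<in> S \<Longrightarrow> t \<in> S \<Longrightarrow> \<bar>w t - w s\<bar> \<le> C * \<bar>t - s\<bar>"
  shows "absolutely_continuous_on S w"
  unfolding absolutely_continuous_on_def
proof (intro allI impI)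
  fix e :: real assume "0 < e"
  \<comment> \<open>A strictly positive constant is needed as divisor, and \<open>C\<close> may be
    zero or negative.\<close>
  define C' where "C' = \<bar>C\<bar> + 1"
  have C': "0 < C'" "C \<le> C'" by (auto simp: C'_def)
  show "\<exists>\<delta>>0. \<forall>\<D>. \<D> division_of \<Union>\<D> \<and> \<Union>\<D> \<subseteq> S \<and> (\<Sum>I\<in>\<D>. Sup I - Inf I) < \<delta> \<longrightarrow>
      (\<Sum>I\<in>\<D>. \<bar>w (Sup I) - w (Inf I)\<bar>) < e"
  proof (intro exI[of _ "e / C'"] conjI allI impI)
    show "0 < e / C'" using \<open>0 < e\<close> C' by simp
    fix \<D> assume D: "\<D> division_of \<Union>\<D> \<and> \<Union>\<D> \<subseteq> S \<and> (\<Sum>I\<in>\<D>. Sup I - Inf I) < e / C'"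
    have "\<bar>w (Sup I) - w (Inf I)\<bar> \<le> C' * (Sup I - Inf I)" if I: "I \<in> \<D>" for I
    proof -
      obtain a b where ab: "I = cbox a b" "I \<noteq> {}" using D I division_ofD(3,4)[of \<D> "\<Union>\<D>" I] by auto
      then have "a \<le> b" "I \<subseteq> S" using D I by auto
      then have "\<bar>w b - w a\<bar> \<le> C * (b - a)" using w[of a b] ab by (auto simp: subset_iff)
      also have "\<dots> \<le> C' * (b - a)" using C' \<open>a \<le> b\<close> by (intro mult_right_mono) auto
      finally show ?thesis using ab \<open>a \<le> b\<close> by simp
    qed
    then have "(\<Sum>I\<in>\<D>. \<bar>w (Sup I) - w (Inf I)\<bar>) \<le> (\<Sum>I\<in>\<D>. C' * (Sup I - Inf I))"
      by (rule sum_mono)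
    also have "\<dots> < C' * (e / C')"
      unfolding sum_distrib_left[symmetric] using D C' by (intro mult_strict_left_mono) auto
    finally show "(\<Sum>I\<in>\<D>. \<bar>w (Sup I) - w (Inf I)\<bar>) < e" using C' by simp
  qed
qed

text \<open>Dominated convergence with majorant \<open>C\<close> times the modulus of the test
  function. The limit \<open>g\<close> is prescribed only almost everywhere, so its measurability
  comes from \<open>v\<close>.\<close>

lemma weak_function_conv_dominated:
  assumes w: "\<And>i. continuous_on {0..T} (w i)"
    and lim: "\<And>\<tau>. \<tau> \<in> {0..T} \<Longrightarrow> (\<lambda>i. w i \<tau>) \<longlonglongrightarrow> v \<tau>"
    and C: "\<And>i \<tau>. \<tau> \<in> {0..T} \<Longrightarrow> \<bar>w i \<tau>\<bar> \<le> C"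
    and g: "AE \<tau> in lebesgue_on {0..T}. g \<tau> = v \<tau>"
  shows "weak_function_conv T w g"
  unfolding weak_function_conv_def
proof (intro allI impI)
  let ?L = "lebesgue_on {0..T}"
  fix \<phi> :: "real \<Rightarrow> real" assume \<phi>: "integrable ?L \<phi>"
  have wm: "w i \<in> borel_measurable ?L" for i
    by (rule continuous_imp_measurable_on_sets_lebesgue[OF w]) simp
  have "v \<in> borel_measurable ?L"
    by (rule borel_measurable_LIMSEQ_real[where u = w]) (use lim wm in auto)
  \<comment> \<open>Extension by zero moves the question to the complete Lebesgue measure, where
    changing a function on a null set preserves measurability.\<close>
  then have "(\<lambda>\<tau>. if \<tau> \<in> {0..T} then v \<tau> else 0) \<in> borel_measurable lebesgue"
    by (rule borel_measurable_if_I) simp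
  moreover have "AE \<tau> in lebesgue. (if \<tau> \<in> {0..T} then v \<tau> else 0) = (if \<tau> \<in> {0..T} then g \<tau> else 0)"
    using g by (subst (asm) AE_restrict_space_iff) (auto elim: AE_mp)
  ultimately have "(\<lambda>\<tau>. if \<tau> \<in> {0..T} then g \<tau> else 0) \<in> borel_measurable lebesgue"
    by (rule borel_measurable_AE)
  then have gm: "g \<in> borel_measurable ?L" by (rule borel_measurable_if_D)
  have conv: "AE \<tau> in ?L. (\<lambda>i. \<phi> \<tau> * w i \<tau>) \<longlonglongrightarrow> \<phi> \<tau> * g \<tau>"
    using g AE_space
  proof eventually_elim
    case (elim \<tau>)
    then show ?case using lim[of \<tau>] by (auto intro!: tendsto_intros)
  qed
  have bound: "AE \<tau> in ?L. norm (\<phi> \<tau> * w i \<tau>) \<le> C * norm (\<phi> \<tau>)" for i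
  proof (rule AE_I2)
    fix \<tau> assume "\<tau> \<in> space ?L"
    then show "norm (\<phi> \<tau> * w i \<tau>) \<le> C * norm (\<phi> \<tau>)"
      using mult_left_mono[OF C[of \<tau> i], of "\<bar>\<phi> \<tau>\<bar>"] by (simp add: abs_mult mult.commute)
  qed
  have dom: "integrable ?L (\<lambda>\<tau>. C * norm (\<phi> \<tau>))" using \<phi> by simp
  have meas: "(\<lambda>\<tau>. \<phi> \<tau> * g \<tau>) \<in> borel_measurable ?L" "\<And>i. (\<lambda>\<tau>. \<phi> \<tau> * w i \<tau>) \<in> borel_measurable ?L"
    using \<phi> gm wm by auto
  show "(\<forall>i. integrable ?L (\<lambda>\<tau>. \<phi> \<tau> * w i \<tau>)) \<and> integrable ?L (\<lambda>\<tau>. \<phi> \<tau> * g \<tau>) \<and>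
      (\<lambda>i. \<integral>\<tau>. \<phi> \<tau> * w i \<tau> \<partial>?L) \<longlonglongrightarrow> (\<integral>\<tau>. \<phi> \<tau> * g \<tau> \<partial>?L)"
    by (intro conjI allI integrable_dominated_convergence2[OF meas dom conv bound]
        integrable_dominated_convergence[OF meas dom conv bound]
        integral_dominated_convergence[OF meas dom conv bound])
qed

lemma measure_concentrated_on_level_set:
  fixes q :: "'a::euclidean_space \<Rightarrow> real"
  assumes \<mu>: "prob_space \<mu>" "sets \<mu> = sets borel" and q: "continuous_on (cbox l u) q"
    and AE: "AE V in \<mu>. V \<in> cbox l u \<and> q V = c"
  shows "measure_support \<mu> \<noteq> {}" "measure_support \<mu> \<subseteq> {V \<in> cbox l u. q V = c}"
proof -
  let ?S = "{V \<in> cbox l u. q V = c}"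
  have S: "closed ?S" by (rule continuous_closed_preimage_constant[OF q closed_cbox])
  have AES: "AE V in \<mu>. V \<in> ?S" using AE by simp
  show "measure_support \<mu> \<subseteq> ?S" by (rule measure_support_subset[OF S \<mu>(2) AES])
  have "bounded ?S" by (rule bounded_subset[OF bounded_cbox]) auto
  then have "compact ?S" using S by (simp add: compact_eq_bounded_closed)
  moreover have "?S \<noteq> {}"
  proof
    assume "?S = {}"
    with AES have "AE V in \<mu>. False" by simp
    then show False using prob_space.AE_False[OF \<mu>(1)] by simp
  qed
  ultimately show "measure_support \<mu> \<noteq> {}" by (rule measure_support_nonempty[OF _ _ \<mu> AES])
qed

text \<open>Links the integral over the orthant in the final statement with the clamped integrand of
  the averaging argument: both integrands equal \<open>F\<close> on the box, which carries the
  measure.\<close>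

lemma set_integral_concentrated_on_cbox:
  fixes F :: "'a::euclidean_space \<Rightarrow> real"
  assumes \<mu>: "prob_space \<mu>" "sets \<mu> = sets borel" and S: "open S" "cbox l u \<subseteq> S"
    and F: "continuous_on S F" and AE: "AE V in \<mu>. V \<in> cbox l u"
  shows "set_integrable \<mu> S F" "(LINT V:S|\<mu>. F V) = (\<integral>V. ext_cont F l u V \<partial>\<mu>)"
proof -
  interpret prob_space \<mu> by (rule \<mu>)
  have Fc: "continuous_on (cbox l u) F" using F S(2) by (rule continuous_on_subset)
  obtain B where B: "\<And>V. V \<in> cbox l u \<Longrightarrow> \<bar>F V\<bar> \<le> B"
    using compact_imp_bounded[OF compact_continuous_image[OF Fc compact_cbox]] by (auto simp: bounded_iff)
  have m: "(\<lambda>V. indicator S V *\<^sub>R F V) \<in> borel_measurable \<mu>"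
    using borel_measurable_continuous_on_indicator[OF _ F] S(1) \<mu>(2) by (simp cong: measurable_cong_sets)
  have m': "ext_cont F l u \<in> borel_measurable \<mu>"
    using borel_measurable_continuous_onI[OF continuous_on_ext_cont[OF Fc]] \<mu>(2) by (simp cong: measurable_cong_sets)
  show "set_integrable \<mu> S F" unfolding set_integrable_def
  proof (rule integrable_const_bound[where B = B, OF _ m])
    show "AE V in \<mu>. norm (indicator S V *\<^sub>R F V) \<le> B"
      using AE by eventually_elim (use B S(2) in \<open>auto simp: indicator_def\<close>)
  qed
  show "(LINT V:S|\<mu>. F V) = (\<integral>V. ext_cont F l u V \<partial>\<mu>)"
    unfolding set_lebesgue_integral_def
  proof (rule integral_cong_AE[OF m m'])
    show "AE V in \<mu>. indicator S V *\<^sub>R F V = ext_cont F l u V"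
      using AE by eventually_elim (use S(2) in auto)
  qed
qed

theorem theorem5p2:
  fixes N :: nat and h T :: real
    and K :: "(real ^ ('m::finite bit0)) set"
    and U :: "real \<Rightarrow> real \<Rightarrow> real ^ ('m bit0)"
    and \<epsilon> :: "nat \<Rightarrow> real"
    and \<mu>0 :: "real \<Rightarrow> (real ^ ('m bit0)) measure"
  assumes N: "N = CARD('m bit0)" and h: "h = 2 * pi / real N" and T: "0 < T"
    and K: "compact K" "K \<subseteq> positive_orthant"
    and init: "\<And>e. e > 0 \<Longrightarrow> U e 0 \<in> K"
    and sol: "\<And>e. e > 0 \<Longrightarrow> full_solution h e T (U e)"
    and eps: "\<And>i. \<epsilon> i > 0" "\<epsilon> \<longlonglongrightarrow> 0"
    and young: "young_measure T \<mu>0"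
    and conv: "young_conv T (\<lambda>i. dirac_young (U (\<epsilon> i))) \<mu>0"
    and inv: "AE \<tau> in lebesgue_on {0..T}. fast_invariant_measure (\<mu>0 \<tau>)"
  shows "\<forall>j\<in>{1..N div 2 + 1}.
    (AE \<tau> in lebesgue_on {0..T}.
       measure_support (\<mu>0 \<tau>) \<subseteq> positive_orthant \<and>
       (\<exists>c. \<forall>V\<in>measure_support (\<mu>0 \<tau>). observable j V = c) \<and>
       set_integrable (\<mu>0 \<tau>) positive_orthant (\<lambda>V. grad (observable j) V \<bullet> diffusion h V)) \<and>
    (\<exists>v. (AE \<tau> in lebesgue_on {0..T}. measurement j (\<mu>0 \<tau>) = v \<tau>) \<and>
       caratheodory_antiderivative T v
         (\<lambda>\<tau>. LINT V:positive_orthant|\<mu>0 \<tau>. grad (observable j) V \<bullet> diffusion h V) \<and>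
       (\<lambda>i. observable j (U (\<epsilon> i) 0)) \<longlonglongrightarrow> v 0 \<and>
       (\<forall>U0. (\<forall>e>0. U e 0 = U0) \<longrightarrow> v 0 = observable j U0)) \<and>
    weak_function_conv T (\<lambda>i \<tau>. observable j (U (\<epsilon> i) \<tau>)) (\<lambda>\<tau>. measurement j (\<mu>0 \<tau>))"
proof
  fix j assume "j \<in> {1..N div 2 + 1}"
  let ?L = "lebesgue_on {0..T}" and ?G = "\<lambda>V. grad (observable j) V \<bullet> diffusion h V"
  have sol_i: "full_solution h (\<epsilon> i) T (U (\<epsilon> i))" for i by (rule sol[OF eps(1)])
  \<comment> \<open>The box is determined by \<open>K\<close> alone and is thus common to all
    indices.\<close>
  obtain l u where lu: "cbox l u \<subseteq> positive_orthant"
    "\<And>i \<tau>. \<tau> \<in> {0..T} \<Longrightarrow> U (\<epsilon> i) \<tau> \<in> cbox l u"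
    using full_solution_box[OF K] sol_i init[OF eps(1)] by (metis (no_types, lifting))
  have Uc: "continuous_on {0..T} (U (\<epsilon> i))" for i by (rule full_solution_continuous[OF sol_i])
  \<comment> \<open>On the orthant the gradient pairing is the explicit derivative along the
    diffusion, whose continuity is known.\<close>
  have Gc: "continuous_on positive_orthant ?G"
    using continuous_on_observable_deriv_diffusion[of j h]
    by (rule continuous_on_cong[THEN iffD1, rotated -1]) (simp_all add: grad_observable)
  have qc: "continuous_on (cbox l u) (observable j)"
    using lu(1) has_derivative_observable
    by (intro continuous_at_imp_continuous_on) (blast intro: has_derivative_continuous)
  \<comment> \<open>This derivative is free of the singular convection term, as the averaging
    argument demands.\<close>
  have qG: "((\<lambda>t. observable j (U (\<epsilon> i) t)) has_real_derivative ?G (U (\<epsilon> i) \<tau>)) (at \<tau> within {0..T})"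
    if "\<tau> \<in> {0..T}" for i \<tau>
  proof -
    have pos: "U (\<epsilon> i) \<tau> \<in> positive_orthant" using lu that by blast
    show ?thesis
      using full_solution_observable_deriv[OF sol_i pos that] by (simp only: grad_observable[OF pos])
  qed
  obtain v C where lip: "\<And>s t. s \<in> {0..T} \<Longrightarrow> t \<in> {0..T} \<Longrightarrow> \<bar>v t - v s\<bar> \<le> C * \<bar>t - s\<bar>"
    and lim: "\<And>\<tau>. \<tau> \<in> {0..T} \<Longrightarrow> (\<lambda>i. observable j (U (\<epsilon> i) \<tau>)) \<longlonglongrightarrow> v \<tau>"
    and conc: "AE \<tau> in ?L. AE V in \<mu>0 \<tau>. V \<in> cbox l u \<and> observable j V = v \<tau>"
    and der: "AE \<tau> in ?L. (v has_real_derivative (\<integral>V. ext_cont ?G l u V \<partial>\<mu>0 \<tau>)) (at \<tau> within {0..T})"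
  proof (rule slow_observable_young_limit[OF T Uc young conv lu(2) qc continuous_on_subset[OF Gc lu(1)] qG])
    fix v C assume *: "\<And>s t. s \<in> {0..T} \<Longrightarrow> t \<in> {0..T} \<Longrightarrow> \<bar>v t - v s\<bar> \<le> C * \<bar>t - s\<bar>"
      "\<And>\<tau>. \<tau> \<in> {0..T} \<Longrightarrow> (\<lambda>i. observable j (U (\<epsilon> i) \<tau>)) \<longlonglongrightarrow> v \<tau>"
      "AE \<tau> in ?L. AE V in \<mu>0 \<tau>. V \<in> cbox l u \<and> observable j V = v \<tau>"
      "AE \<tau> in ?L. (v has_real_derivative (\<integral>V. ext_cont ?G l u V \<partial>\<mu>0 \<tau>)) (at \<tau> within {0..T})"
    show thesis by (rule that[OF *])
  qed
  \<comment> \<open>Everything that concentration on one level set within the box implies at a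
    single time; it is applied at almost every time below.\<close>
  have level: "measure_support (\<mu>0 \<tau>) \<noteq> {}"
      "measure_support (\<mu>0 \<tau>) \<subseteq> {V \<in> cbox l u. observable j V = v \<tau>}"
      "set_integrable (\<mu>0 \<tau>) positive_orthant ?G"
      "(LINT V:positive_orthant|\<mu>0 \<tau>. ?G V) = (\<integral>V. ext_cont ?G l u V \<partial>\<mu>0 \<tau>)"
    if \<tau>: "\<tau> \<in> space ?L" and AE: "AE V in \<mu>0 \<tau>. V \<in> cbox l u \<and> observable j V = v \<tau>" for \<tau>
  proof -
    have "\<tau> \<in> {0..T}" using \<tau> by simp
    note \<mu> = young_measureD[OF young this]
    show "measure_support (\<mu>0 \<tau>) \<noteq> {}"
      "measure_support (\<mu>0 \<tau>) \<subseteq> {V \<in> cbox l u. observable j V = v \<tau>}"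
      by (rule measure_concentrated_on_level_set[OF \<mu> qc AE])+
    have AE': "AE V in \<mu>0 \<tau>. V \<in> cbox l u" using AE by eventually_elim simp
    show "set_integrable (\<mu>0 \<tau>) positive_orthant ?G"
      "(LINT V:positive_orthant|\<mu>0 \<tau>. ?G V) = (\<integral>V. ext_cont ?G l u V \<partial>\<mu>0 \<tau>)"
      by (rule set_integral_concentrated_on_cbox[OF \<mu> open_positive_orthant lu(1) Gc AE'])+
  qed
  have meas: "AE \<tau> in ?L. measurement j (\<mu>0 \<tau>) = v \<tau>"
    using conc AE_space
  proof eventually_elim
    case (elim \<tau>)
    show ?case by (rule measurement_eq) (use level(1,2)[OF elim(2,1)] in auto)
  qed
  have "AE \<tau> in ?L. measure_support (\<mu>0 \<tau>) \<subseteq> positive_orthant \<and>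
      (\<exists>c. \<forall>V\<in>measure_support (\<mu>0 \<tau>). observable j V = c) \<and>
      set_integrable (\<mu>0 \<tau>) positive_orthant ?G"
    using conc AE_space
  proof eventually_elim
    case (elim \<tau>)
    then show ?case using level(2,3)[OF elim(2,1)] lu(1) by blast
  qed
  moreover have "caratheodory_antiderivative T v (\<lambda>\<tau>. LINT V:positive_orthant|\<mu>0 \<tau>. ?G V)"
    unfolding caratheodory_antiderivative_def
  proof
    show "absolutely_continuous_on {0..T} v"
      by (rule lipschitz_imp_absolutely_continuous_on[OF lip])
    show "AE \<tau> in ?L. (v has_real_derivative (LINT V:positive_orthant|\<mu>0 \<tau>. ?G V)) (at \<tau> within {0..T})"
      using conc der AE_space
    proof eventually_elim
      case (elim \<tau>)
      \<comment> \<open>The derivative is known in terms of the clamped integrand, which integrates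
        to the same value.\<close>
      then show ?case using level(4)[OF elim(3,1)] by simp
    qed
  qed
  moreover have lim0: "(\<lambda>i. observable j (U (\<epsilon> i) 0)) \<longlonglongrightarrow> v 0"
    using T by (intro lim) simp
  \<comment> \<open>With a fixed initial point the sequence at time 0 is constant, so its limit is
    that value.\<close>
  moreover have "v 0 = observable j U0" if "\<forall>e>0. U e 0 = U0" for U0
    using lim0 that eps(1) by (simp add: LIMSEQ_const_iff)
  moreover have "weak_function_conv T (\<lambda>i \<tau>. observable j (U (\<epsilon> i) \<tau>)) (\<lambda>\<tau>. measurement j (\<mu>0 \<tau>))"
  proof -
    obtain B where B: "\<And>V. V \<in> cbox l u \<Longrightarrow> \<bar>observable j V\<bar> \<le> B"
      using compact_imp_bounded[OF compact_continuous_image[OF qc compact_cbox]] by (auto simp: bounded_iff)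
    show ?thesis
    proof (rule weak_function_conv_dominated[OF _ lim _ meas])
      show "continuous_on {0..T} (\<lambda>\<tau>. observable j (U (\<epsilon> i) \<tau>))" for i
        by (rule continuous_on_compose2[OF qc Uc]) (use lu(2) in auto)
      show "\<bar>observable j (U (\<epsilon> i) \<tau>)\<bar> \<le> B" if "\<tau> \<in> {0..T}" for i \<tau>
        by (rule B[OF lu(2)[OF that]])
    qed
  qed
  ultimately show "(AE \<tau> in ?L. measure_support (\<mu>0 \<tau>) \<subseteq> positive_orthant \<and>
       (\<exists>c. \<forall>V\<in>measure_support (\<mu>0 \<tau>). observable j V = c) \<and>
       set_integrable (\<mu>0 \<tau>) positive_orthant ?G) \<and>
    (\<exists>v. (AE \<tau> in ?L. measurement j (\<mu>0 \<tau>) = v \<tau>) \<and>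
       caratheodory_antiderivative T v (\<lambda>\<tau>. LINT V:positive_orthant|\<mu>0 \<tau>. ?G V) \<and>
       (\<lambda>i. observable j (U (\<epsilon> i) 0)) \<longlonglongrightarrow> v 0 \<and>
       (\<forall>U0. (\<forall>e>0. U e 0 = U0) \<longrightarrow> v 0 = observable j U0)) \<and>
    weak_function_conv T (\<lambda>i \<tau>. observable j (U (\<epsilon> i) \<tau>)) (\<lambda>\<tau>. measurement j (\<mu>0 \<tau>))"
    using meas by blast
qed

end
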